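(* Let $q$ be a prime power, let $n$ be a positive integer, let $s$ be an integer with $\gcd(s,2n)=1$, let $k$ be an integer with $1\le k\le 2n-1$, and let $\gamma\in\mathbb F_{q^{2n}}$ be such that $N(\gamma)$ is a non-square in $\mathbb F_q$. In $\mathbb F_q^{2n\times 2n}$, the MRD code $\mathcal D_{k,s}(\gamma)$ is not equivalent to any generalized Gabidulin code. Moreover, when $k\ne n$ or $h\ne n$, $\mathcal D_{k,s}(\gamma)$ is also not equivalent to any generalized twisted Gabidulin code $\mathcal H_{k,t}(\eta,h)$ with $\eta\neq 0$.
   Context: $N=N_{q^{2n}/q}$ denotes the norm from $\mathbb F_{q^{2n}}$ to $\mathbb F_q$. A $q$-polynomial over $\mathbb F_{q^{2n}}$ is a polynomial $\sum_i c_iX^{q^i}$ with $c_i\in\mathbb F_{q^{2n}}$; $q$-polynomials are considered modulo $X^{q^{2n}}-X$ (so the exponent $i$ in $X^{q^i}$ is read modulo $2n$) and are identified with $\mathbb F_q$-linear maps of $\mathbb F_{q^{2n}}$, i.e. with matrices in $\mathbb F_q^{2n\times 2n}$. The code $\mathcal D_{k,s}(\gamma)$ is $$\mathcal D_{k,s}(\gamma)=\Big\{aX+\sum_{i=1}^{k-1}c_iX^{q^{is}}+\gamma bX^{q^{ks}} : c_1,\dots,c_{k-1}\in\mathbb F_{q^{2n}},\ a,b\in\mathbb F_{q^n}\Big\}.$$ A generalized Gabidulin code in $\mathbb F_q^{2n\times 2n}$ is a set $\mathcal G_{k',t}=\{a_0X+a_1X^{q^t}+\dots+a_{k'-1}X^{q^{t(k'-1)}}: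 a_i\in\mathbb F_{q^{2n}}\}$ with $\gcd(t,2n)=1$. A generalized twisted Gabidulin code is a set $$\mathcal H_{k,t}(\eta,h)=\{a_0X+a_1X^{q^t}+\dots+a_{k-1}X^{q^{t(k-1)}}+\eta a_0^{q^h}X^{q^{tk}}: a_i\in\mathbb F_{q^{2n}}\},$$ with $\gcd(t,2n)=1$, $\eta\in\mathbb F_{q^{2n}}$ with $N(\eta)\ne(-1)^{2nk}=1$, and $h$ an integer taken modulo $2n$ (with representative $0\le h\le 2n-1$). Two sets $\mathcal C_1,\mathcal C_2$ of $q$-polynomials over $\mathbb F_{q^{2n}}$ are equivalent if there exist $q$-polynomials $\varphi_1,\varphi_2$ over $\mathbb F_{q^{2n}}$ permuting $\mathbb F_{q^{2n}}$, a $q$-polynomial $\psi$ over $\mathbb F_{q^{2n}}$ and $\rho\in\mathrm{Aut}(\mathbb F_q)$ such that $\mathcal C_2=\{\varphi_1\circ f^\rho\circ\varphi_2+\psi: f\in\mathcal C_1\}$, where $f^\rho=\sum a_i^\rho X^{q^i}$ for $f=\sum a_iX^{q^i}$; here $\rho$, a power map $x\mapsto x^{p^e}$ with $p=\mathrm{char}\,\mathbb F_q$, is applied to elements of $\mathbb F_{q^{2n}}$ by the same power map.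
   Formalization: The formal statement assumes n ≥ 2; for n = 1 both claims fail: with w² = N(γ) and φ = X + (γ/w)X^q, φ∘D∘φ⁻¹ = {cX : c ∈ F_{q²}}, a Gabidulin code, also equivalent to every H_{1,t}(η,0) with η ≠ 0 and N(η) ≠ 1. *)

theory Defs
  imports
    "HOL-Computational_Algebra.Computational_Algebra"
    "HOL-Number_Theory.Prime_Powers"
    "HOL-Library.Cardinality"
begin

text \<open>
  Throughout, the type \<open>'a\<close> is a finite field with \<open>q ^ (2 * n)\<close> elements. The residue class of a
  \<open>q\<close>-polynomial modulo \<open>X^(q^(2n)) - X\<close> is represented by its unique member of
  degree less than \<open>q ^ (2 * n)\<close>.
\<close>

definition Fsub :: "nat \<Rightarrow> nat \<Rightarrow> 'a::field set"
  where "Fsub q m = {x. x ^ (q ^ m) = x}"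

definition norm_Fq :: "nat \<Rightarrow> nat \<Rightarrow> 'a::field \<Rightarrow> 'a"
  where "norm_Fq q n x = (\<Prod>i<2 * n. x ^ (q ^ i))"

text \<open>The \<open>q\<close>-monomial \<open>c X^(q^j)\<close>, with the integer \<open>j\<close> read modulo \<open>2n\<close>.\<close>

definition qmonom :: "nat \<Rightarrow> nat \<Rightarrow> 'a::field \<Rightarrow> int \<Rightarrow> 'a poly"
  where "qmonom q n c j = monom c (q ^ nat (j mod int (2 * n)))"

definition qpolys :: "nat \<Rightarrow> nat \<Rightarrow> 'a::field poly set"
  where "qpolys q n = {\<Sum>i<2 * n. qmonom q n (c i) (int i) | c. True}"

definition qreduce :: "nat \<Rightarrow> nat \<Rightarrow> 'a::field poly \<Rightarrow> 'a poly"
  where "qreduce q n f = f mod (monom 1 (q ^ (2 * n)) - monom 1 1)"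

definition qcompose :: "nat \<Rightarrow> nat \<Rightarrow> 'a::field poly \<Rightarrow> 'a poly \<Rightarrow> 'a poly"
  where "qcompose q n f g = qreduce q n (pcompose f g)"

text \<open>
  The automorphism \<open>\<rho>\<close> is given by an exponent \<open>e\<close>. All \<open>e\<close> are allowed: if \<open>q = p ^ m\<close>, replacing \<open>e\<close>
  by \<open>e + m\<close> changes the twisted polynomial only by conjugation with the \<open>q\<close>-polynomial \<open>X^q\<close>, which
  can be absorbed into \<open>\<phi>\<^sub>1\<close> and \<open>\<phi>\<^sub>2\<close>.
\<close>

definition code_equivalent ::
    "nat \<Rightarrow> nat \<Rightarrow> 'a::field poly set \<Rightarrow> 'a poly set \<Rightarrow> bool"
  where "code_equivalent q n C1 C2 \<longleftrightarrow>
    (\<exists>\<phi>1\<in>qpolys q n. \<exists>\<phi>2\<in>qpolys q n. \<exists>\<psi>\<in>qpolys q n. \<exists>e.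
       bij (poly \<phi>1) \<and> bij (poly \<phi>2) \<and>
       C2 = {qcompose q n \<phi>1 (qcompose q n (map_poly (\<lambda>x. x ^ (CHAR('a) ^ e)) f) \<phi>2) + \<psi> | f.
               f \<in> C1})"

definition code_D :: "nat \<Rightarrow> nat \<Rightarrow> nat \<Rightarrow> int \<Rightarrow> 'a::field \<Rightarrow> 'a poly set"
  where "code_D q n k s \<gamma> =
    {qmonom q n a 0 + (\<Sum>i\<in>{1..k - 1}. qmonom q n (c i) (int i * s))
       + qmonom q n (\<gamma> * b) (int k * s) | a b c. a \<in> Fsub q n \<and> b \<in> Fsub q n}"

definition gabidulin :: "nat \<Rightarrow> nat \<Rightarrow> nat \<Rightarrow> int \<Rightarrow> 'a::field poly set"
  where "gabidulin q n k t = {\<Sum>i<k. qmonom q n (a i) (t * int i) | a. True}"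

definition twisted_gabidulin ::
    "nat \<Rightarrow> nat \<Rightarrow> nat \<Rightarrow> int \<Rightarrow> 'a::field \<Rightarrow> nat \<Rightarrow> 'a poly set"
  where "twisted_gabidulin q n k t \<eta> h =
    {(\<Sum>i<k. qmonom q n (a i) (t * int i)) + qmonom q n (\<eta> * a 0 ^ (q ^ h)) (t * int k) | a. True}"

end

theory Submission
  imports Defs "HOL-Number_Theory.Cong"
begin

text \<open>
  Equivalent codes have left and right idealisers of the same size, where the left idealiser of a
  code \<open>C\<close> consists of the \<open>q\<close>-linear maps \<open>\<phi>\<close> with \<open>\<phi> \<circ> f \<in> C\<close> for all \<open>f \<in> C\<close>, and the right
  idealiser is defined by \<open>f \<circ> \<phi> \<in> C\<close>. Indeed, an equivalence conjugates idealisers by bijections that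
  normalise the ring of \<open>q\<close>-linear maps (\<open>code_equivalent_functions\<close>, \<open>card_idealisers_eq\<close>). The theorem
  follows by comparing these sizes.

  Let \<open>N = 2 * n\<close>. The codes \<open>\<D>\<^sub>k\<^sub>,\<^sub>s(\<gamma>)\<close> and \<open>\<H>\<^sub>k\<^sub>,\<^sub>t(\<eta>,h)\<close> are described by the coefficients of their words in
  the positions \<open>0, \<dots>, k\<close>, counted in multiples of \<open>s\<close> or \<open>t\<close> modulo \<open>N\<close>: the inner coefficients are free,
  while the end coefficients are restricted. If \<open>\<phi>\<close> lies in an idealiser, each monomial of \<open>\<phi>\<close> translates
  the set of inner positions. Two degenerate choices of \<open>h\<close> apart, it cannot send an inner position to an
  end, because a free coefficient would arrive at a restricted place. So it maps a proper interval of the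
  cyclic group of order \<open>N\<close> into itself, and only the translation by \<open>0\<close> does that
  (\<open>interval_shift_invariant\<close>). Hence \<open>\<phi>\<close> is a scaling \<open>x \<mapsto> d * x\<close>. For \<open>k = 1\<close> there are no inner
  positions, and the two end positions take over this role.

  For \<open>\<D>\<^sub>k\<^sub>,\<^sub>s(\<gamma>)\<close> the possible factors \<open>d\<close> are exactly the elements of the subfield of order \<open>q ^ n\<close>, on both sides.
  A Gabidulin code has all \<open>q ^ (2 * n)\<close> scalings in its left idealiser, so it is not
  equivalent to \<open>\<D>\<^sub>k\<^sub>,\<^sub>s(\<gamma>)\<close>. The degenerate twisted codes fail likewise: \<open>\<H>\<^sub>k\<^sub>,\<^sub>t(\<eta>,h)\<close> has all scalings in its
  left idealiser if \<open>h = 0\<close> modulo \<open>N\<close>, and in its right idealiser if \<open>h = t * k\<close>. Otherwise \<open>d\<close> is fixed by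
  \<open>x \<mapsto> x ^ (q ^ h)\<close> on the left and by \<open>x \<mapsto> x ^ (q ^ (t * k - h))\<close> on the right
  (\<open>left_idealiser_H\<close>, \<open>right_idealiser_H\<close>). A nontrivial power of Frobenius has at least \<open>q ^ n\<close> fixed points only
  if its exponent is \<open>n\<close> modulo \<open>N\<close> (\<open>large_fixed_by\<close>). An equivalence would thus give \<open>h = n\<close>
  and \<open>t * k - h = n\<close>, hence \<open>t * k = 0\<close> modulo \<open>N\<close>, which is impossible for \<open>1 \<le> k < N\<close> with \<open>t\<close> a unit.
\<close>

section \<open>Finite fields and cyclic intervals\<close>

lemma power_card_field:
  fixes x :: "'a::{field,finite}"
  shows "x ^ CARD('a) = x"
proof (cases "x = 0")
  case False
  have "(\<Prod>y\<in>UNIV - {0}. x * y) = \<Prod>(UNIV - {0})"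
    by (rule prod.reindex_bij_witness[of _ "\<lambda>y. y / x" "\<lambda>y. x * y"]) (use False in auto)
  then have "x ^ card (UNIV - {0::'a}) * \<Prod>(UNIV - {0::'a}) = \<Prod>(UNIV - {0})"
    by (simp add: prod.distrib del: card_Diff_insert)
  moreover have "\<Prod>(UNIV - {0::'a}) \<noteq> 0"
    by auto
  ultimately have "x ^ card (UNIV - {0::'a}) = 1"
    by (metis mult_cancel_right1)
  then have "x ^ Suc (card (UNIV - {0::'a})) = x"
    by (metis power_Suc mult_1_right)
  then show ?thesis
    by (metis card.remove finite_class.finite_UNIV iso_tuple_UNIV_I)
qed simp

text \<open>
  Translation by \<open>1\<close> permutes the field, so it does not change the sum of all elements.
\<close>

lemma of_nat_card_field: "of_nat CARD('a) = (0 :: 'a::{field,finite})"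
proof -
  have "(\<Sum>x\<in>UNIV. x + (1::'a)) = (\<Sum>x\<in>UNIV. x)"
    by (rule sum.reindex_bij_witness[of _ "\<lambda>y. y - 1" "\<lambda>y. y + 1"]) auto
  then show ?thesis
    by (simp add: sum.distrib)
qed

lemma prime_char_finite_field: "prime CHAR('a::{field,finite})"
  by (intro prime_CHAR_semidom finite_imp_CHAR_pos) simp

text \<open>
  On the level of maps, twisting the coefficients by a field automorphism \<open>\<rho>\<close> is conjugation by
  \<open>\<rho>\<close>. The automorphism in a code equivalence can therefore be absorbed into the outer maps.
\<close>

lemma poly_map_poly_power_CHAR:
  fixes f :: "'a::{field,finite} poly" and e :: nat
  defines "\<rho> \<equiv> \<lambda>x::'a. x ^ (CHAR('a) ^ e)"
  shows "poly (map_poly \<rho> f) (\<rho> x) = \<rho> (poly f x)"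
proof (induction f)
  case 0
  then show ?case
    using prime_char_finite_field[where 'a='a] by (auto simp: \<rho>_def power_0_left prime_gt_0_nat)
next
  case (pCons a f)
  have "\<rho> 0 = 0"
    using prime_char_finite_field[where 'a='a] by (auto simp: \<rho>_def power_0_left prime_gt_0_nat)
  with pCons show ?case
    using freshmans_dream'[OF prime_char_finite_field[where 'a='a] refl, of a "x * poly f x" e]
    by (simp add: map_poly_pCons \<rho>_def power_mult_distrib)
qed

lemma bij_power_CHAR:
  "bij (\<lambda>x::'a::{field,finite}. x ^ (CHAR('a) ^ e))"
proof -
  have "inj (\<lambda>x::'a. x ^ (CHAR('a) ^ e))"
  proof (rule injI)
    fix x y :: 'a
    assume *: "x ^ (CHAR('a) ^ e) = y ^ (CHAR('a) ^ e)"
    have "(x - y) ^ (CHAR('a) ^ e) + y ^ (CHAR('a) ^ e) = x ^ (CHAR('a) ^ e)"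
      using freshmans_dream'[OF prime_char_finite_field[where 'a='a] refl, of "x - y" y e] by simp
    with * show "x = y"
      by simp
  qed
  then show ?thesis
    by (simp add: bij_def finite_UNIV_inj_surj)
qed

text \<open>
  A nonempty interval of residues modulo \<open>N\<close> that is not everything has only trivial stabiliser under
  translation: a translation by \<open>0 < r < N\<close> sends some point of the interval to the first place
  after its right end or, if \<open>r\<close> exceeds the length, sends the left end into the gap. This is what
  forces the elements of an idealiser to have a single monomial.
\<close>

lemma interval_shift_invariant:
  fixes a b m N :: int
  assumes "a \<le> b" "b - a + 1 < N"
    and shift: "\<And>j. a \<le> j \<Longrightarrow> j \<le> b \<Longrightarrow> \<exists>i\<in>{a..b}. [m + j = i] (mod N)"
  shows "N dvd m"
proof (rule ccontr)
  assume ndvd: "\<not> N dvd m"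
  define r where "r = m mod N"
  have r: "0 < r" "r < N"
    using assms(1,2) ndvd pos_mod_bound[of N m] pos_mod_sign[of N m]
    by (auto simp: r_def dvd_eq_mod_eq_0 less_le)
  have shift': "\<exists>i\<in>{a..b}. N dvd r + j - i" if "a \<le> j" "j \<le> b" for j
  proof -
    from shift[OF that] obtain i where "i \<in> {a..b}" "N dvd m + j - i"
      by (auto simp: cong_iff_dvd_diff)
    moreover have "r + j - i = (m + j - i) - N * (m div N)"
      by (simp add: r_def minus_mult_div_eq_mod[symmetric])
    ultimately show ?thesis
      by (metis dvd_diff dvd_triv_left)
  qed
  have no: "\<not> N dvd d" if "0 < d" "d < N" for d
    using that zdvd_not_zless by blast
  \<comment> \<open>The point moved to \<open>b + 1\<close> is \<open>b + 1 - r\<close>, provided it lies in the interval.\<close>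
  show False
  proof (cases "r \<le> b - a + 1")
    case True
    then obtain i where "i \<in> {a..b}" "N dvd r + (b + 1 - r) - i"
      using shift'[of "b + 1 - r"] r by auto
    then show False
      using no[of "b + 1 - i"] assms by auto
  next
    case False
    then obtain i where "i \<in> {a..b}" "N dvd r + a - i"
      using shift'[of a] assms by auto
    then show False
      using no[of "r + a - i"] False r by auto
  qed
qed

section \<open>Powers of Frobenius and coefficients of q-linear maps\<close>

locale field_q2n =
  fixes q n :: nat and ty :: "'a::{field,finite} itself"
  assumes primepow_q: "primepow q" and n_ge_2: "2 \<le> n" and card_field: "CARD('a) = q ^ (2 * n)"
begin

definition N :: int where "N = int (2 * n)"

text \<open>
  The integer exponent makes the powers of the Frobenius map a group: \<open>frob\<close> depends only on \<open>j\<close> modulo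
  \<open>N = 2 * n\<close>, and \<open>frob i \<circ> frob j = frob (i + j)\<close>.
\<close>

definition frob :: "int \<Rightarrow> 'a \<Rightarrow> 'a"
  where "frob j x = x ^ (q ^ nat (j mod N))"

text \<open>
  The maps induced by \<open>q\<close>-polynomials.
\<close>

definition qlin :: "('a \<Rightarrow> 'a) set"
  where "qlin = range (\<lambda>c x. \<Sum>i\<in>{0..<N}. c i * frob i x)"

text \<open>
  The coefficient of \<open>X^(q^j)\<close> in a map induced by a \<open>q\<close>-polynomial. The choice is harmless because the
  expansion is unique (\<open>frob_independent\<close>); like \<open>frob j\<close>, the coefficient depends on \<open>j\<close> modulo \<open>N\<close>.
\<close>

definition cf :: "('a \<Rightarrow> 'a) \<Rightarrow> int \<Rightarrow> 'a"
  where "cf f j = (SOME c. f = (\<lambda>x. \<Sum>i\<in>{0..<N}. c i * frob i x)) (j mod N)"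

lemma N_ge_4: "4 \<le> N"
  using n_ge_2 by (simp add: N_def)

lemma N_pos [simp]: "0 < N" "0 \<le> N" "N \<noteq> 0"
  using N_ge_4 by auto

lemma q_eq: "\<exists>m>0. q = CHAR('a) ^ m"
proof -
  obtain p m where pm: "prime p" "m > 0" "q = p ^ m"
    using primepow_q by (auto simp: primepow_def)
  have "of_nat p ^ (m * (2 * n)) = (0::'a)"
    using of_nat_card_field[where 'a='a] pm(3) by (simp add: card_field power_mult)
  then have "CHAR('a) dvd p"
    by (simp add: of_nat_eq_0_iff_char_dvd)
  with pm(1) have "p = CHAR('a)"
    using prime_char_finite_field primes_dvd_imp_eq by metis
  with pm show ?thesis by auto
qed

lemma q_gt_1: "1 < q"
  using q_eq prime_char_finite_field[where 'a='a] one_less_power prime_gt_1_nat by metis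

lemma power_q2n [simp]: "(x::'a) ^ (q ^ (2 * n)) = x"
  using power_card_field[of x] by (simp add: card_field)

lemma power_q_mod: "(x::'a) ^ (q ^ i) = x ^ (q ^ (i mod (2 * n)))"
proof -
  have "x ^ (q ^ (2 * n * k + r)) = x ^ (q ^ r)" for k r
  proof (induction k)
    case (Suc k)
    have "x ^ (q ^ (2 * n * Suc k + r)) = (x ^ (q ^ (2 * n))) ^ (q ^ (2 * n * k + r))"
      unfolding power_mult[symmetric] power_add[symmetric] by (simp add: algebra_simps)
    with Suc show ?case by simp
  qed simp
  from this[of "i div (2 * n)" "i mod (2 * n)"] show ?thesis by simp
qed

lemma frob_nat: "frob (int i) x = x ^ (q ^ i)"
  by (metis N_def frob_def nat_int power_q_mod zmod_int)

lemma frob_cong: "[i = j] (mod N) \<Longrightarrow> frob i = frob j"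
  by (simp add: frob_def cong_def fun_eq_iff)

lemma frob_mod [simp]: "frob (i mod N) = frob i"
  by (rule frob_cong) simp

lemma frob_frob: "frob i (frob j x) = frob (i + j) x"
proof -
  have "frob i (frob j x) = frob (int (nat (i mod N) + nat (j mod N))) x"
    by (simp only: frob_nat) (simp add: frob_def power_add mult.commute flip: power_mult)
  also have "\<dots> = frob (i + j) x"
    by (rule fun_cong[OF frob_cong]) (simp add: cong_def mod_simps)
  finally show ?thesis .
qed

lemma frob_0 [simp]: "frob 0 x = x"
  by (simp add: frob_def)

lemma frob_add: "frob j (x + y) = frob j x + frob j y"
proof -
  obtain m where "q = CHAR('a) ^ m" using q_eq by blast
  then show ?thesis
    unfolding frob_def
    by (intro freshmans_dream'[where n="m * nat (j mod N)"] prime_char_finite_field) (simp add: power_mult)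
qed

lemma frob_mult: "frob j (x * y) = frob j x * frob j y"
  by (simp add: frob_def power_mult_distrib)

lemma frob_0_right [simp]: "frob j 0 = 0"
  using q_gt_1 by (simp add: frob_def)

lemma frob_1_right [simp]: "frob j 1 = 1"
  by (simp add: frob_def)

lemma frob_eq_0_iff [simp]: "frob j x = 0 \<longleftrightarrow> x = 0"
  using q_gt_1 by (auto simp: frob_def)

lemma frob_diff: "frob j (x - y) = frob j x - frob j y"
  using frob_add[of j "x - y" y] by simp

lemma frob_sum: "frob j (sum f A) = (\<Sum>i\<in>A. frob j (f i))"
  by (induction A rule: infinite_finite_induct) (auto simp: frob_add)

lemma frob_power: "frob j (x ^ m) = frob j x ^ m"
  by (simp add: frob_def mult.commute flip: power_mult)

text \<open>
  The left side comes from a polynomial of degree at most \<open>q ^ (2 * n - 1)\<close>, too small to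
  vanish at all \<open>q ^ (2 * n)\<close> points unless it is zero.
\<close>

lemma frob_independent:
  assumes "\<And>x. (\<Sum>i\<in>{0..<N}. c i * frob i x) = 0" and "i \<in> {0..<N}"
  shows "c i = 0"
proof -
  define p where "p = (\<Sum>i\<in>{0..<N}. monom (c i) (q ^ nat i))"
  have nat_less: "nat i < 2 * n" if "i \<in> {0..<N}" for i
    using that by (auto simp: N_def)
  have "degree p < q ^ (2 * n)"
    unfolding p_def
  proof (rule degree_sum_less)
    fix i assume "i \<in> {0..<N}"
    then have "q ^ nat i < q ^ (2 * n)"
      using nat_less q_gt_1 by simp
    then show "degree (monom (c i) (q ^ nat i)) < q ^ (2 * n)"
      using degree_monom_le le_less_trans by blast
  qed (use q_gt_1 in simp)
  moreover have "poly p x = 0" for x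
  proof -
    have "poly p x = (\<Sum>i\<in>{0..<N}. c i * frob i x)"
      by (auto simp: p_def poly_sum poly_monom frob_def intro!: sum.cong)
    with assms(1) show ?thesis by simp
  qed
  ultimately have "p = 0"
    by (intro poly_eqI_degree[of UNIV]) (use q_gt_1 in \<open>auto simp: card_field\<close>)
  moreover have "coeff p (q ^ nat i) = (\<Sum>j\<in>{0..<N}. if j = i then c i else 0)"
    unfolding p_def coeff_sum
    using q_gt_1 assms(2) by (intro sum.cong) (auto simp: coeff_monom)
  ultimately show ?thesis
    using assms(2) by simp
qed

lemma cf_unique:
  assumes "f = (\<lambda>x. \<Sum>i\<in>{0..<N}. c i * frob i x)"
  shows "cf f j = c (j mod N)"
proof -
  define d where "d = (SOME c. f = (\<lambda>x. \<Sum>i\<in>{0..<N}. c i * frob i x))"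
  have "f = (\<lambda>x. \<Sum>i\<in>{0..<N}. d i * frob i x)"
    unfolding d_def using assms
    by (rule someI[where P="\<lambda>c. f = (\<lambda>x. \<Sum>i\<in>{0..<N}. c i * frob i x)"])
  then have "(\<Sum>i\<in>{0..<N}. (d i - c i) * frob i x) = 0" for x
    using assms by (auto simp: left_diff_distrib sum_subtractf fun_eq_iff)
  then have "d (j mod N) - c (j mod N) = 0"
    by (rule frob_independent[of "\<lambda>i. d i - c i"]) simp
  then show ?thesis
    by (simp add: cf_def d_def)
qed

lemma qlin_expand:
  assumes "f \<in> qlin"
  shows "f x = (\<Sum>i\<in>{0..<N}. cf f i * frob i x)"
proof -
  obtain c where c: "f = (\<lambda>x. \<Sum>i\<in>{0..<N}. c i * frob i x)"
    using assms by (auto simp: qlin_def)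
  show ?thesis
    by (subst c) (auto intro!: sum.cong simp: cf_unique[OF c])
qed

lemma cf_cong: "[i = j] (mod N) \<Longrightarrow> cf f i = cf f j"
  by (simp add: cf_def cong_def)

lemma qlinI: "f = (\<lambda>x. \<Sum>i\<in>{0..<N}. c i * frob i x) \<Longrightarrow> f \<in> qlin"
  by (auto simp: qlin_def)

lemma zero_expand: "(\<lambda>x::'a. 0) = (\<lambda>x. \<Sum>i\<in>{0..<N}. (\<lambda>_. 0) i * frob i x)"
  by simp

lemma add_expand:
  assumes "f \<in> qlin" "g \<in> qlin"
  shows "(\<lambda>x. f x + g x) = (\<lambda>x. \<Sum>i\<in>{0..<N}. (\<lambda>i. cf f i + cf g i) i * frob i x)"
  using assms[THEN qlin_expand] by (auto simp: fun_eq_iff sum.distrib distrib_right)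

lemma sum_cyclic_shift:
  assumes "\<And>i. g (i mod N) = g i"
  shows "(\<Sum>i\<in>{0..<N}. g (i + m)) = (\<Sum>i\<in>{0..<N}. g i)"
  by (rule sum.reindex_bij_witness[of _ "\<lambda>i. (i - m) mod N" "\<lambda>i. (i + m) mod N"])
     (auto simp: mod_simps assms)

lemma cf_mod [simp]: "cf f (i mod N) = cf f i"
  by (rule cf_cong) simp

lemma frob_left_expand:
  assumes "f \<in> qlin"
  shows "(\<lambda>x. c * frob m (f x)) = (\<lambda>x. \<Sum>i\<in>{0..<N}. (\<lambda>i. c * frob m (cf f (i - m))) i * frob i x)"
proof
  fix x
  have "c * frob m (f x) = (\<Sum>i\<in>{0..<N}. c * frob m (cf f ((i + m) - m)) * frob (i + m) x)"
    by (simp add: qlin_expand[OF assms] frob_sum sum_distrib_left frob_mult frob_frob mult.assoc add.commute)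
  also have "\<dots> = (\<Sum>i\<in>{0..<N}. c * frob m (cf f (i - m)) * frob i x)"
    by (rule sum_cyclic_shift[where g="\<lambda>i. c * frob m (cf f (i - m)) * frob i x"])
       (simp, metis cf_mod mod_diff_left_eq)
  finally show "c * frob m (f x) = (\<Sum>i\<in>{0..<N}. (\<lambda>i. c * frob m (cf f (i - m))) i * frob i x)"
    by simp
qed

lemma frob_right_expand:
  assumes "f \<in> qlin"
  shows "(\<lambda>x. f (c * frob m x)) = (\<lambda>x. \<Sum>i\<in>{0..<N}. (\<lambda>i. cf f (i - m) * frob (i - m) c) i * frob i x)"
proof
  fix x
  have "f (c * frob m x) = (\<Sum>i\<in>{0..<N}. cf f ((i + m) - m) * frob ((i + m) - m) c * frob (i + m) x)"
    by (simp add: qlin_expand[OF assms] frob_mult frob_frob mult.assoc)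
  also have "\<dots> = (\<Sum>i\<in>{0..<N}. cf f (i - m) * frob (i - m) c * frob i x)"
    by (rule sum_cyclic_shift[where g="\<lambda>i. cf f (i - m) * frob (i - m) c * frob i x"])
       (simp, metis cf_mod frob_mod mod_diff_left_eq)
  finally show "f (c * frob m x) = (\<Sum>i\<in>{0..<N}. (\<lambda>i. cf f (i - m) * frob (i - m) c) i * frob i x)"
    by simp
qed

lemma id_expand: "(\<lambda>x. x) = (\<lambda>x. \<Sum>i\<in>{0..<N}. (\<lambda>i. if i = 0 then 1 else 0) i * frob i x)"
proof
  fix x
  have "(\<Sum>i\<in>{0..<N}. (\<lambda>i. if i = 0 then 1 else 0) i * frob i x) = (\<Sum>i\<in>{0..<N}. if i = 0 then x else 0)"
    by (intro sum.cong) auto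
  then show "x = (\<Sum>i\<in>{0..<N}. (\<lambda>i. if i = 0 then 1 else 0) i * frob i x)"
    by simp
qed

lemmas qlin_zero [simp] = qlinI[OF zero_expand]
lemmas qlin_add [intro] = qlinI[OF add_expand]
lemmas qlin_frob_left [intro] = qlinI[OF frob_left_expand]
lemmas qlin_frob_right [intro] = qlinI[OF frob_right_expand]
lemmas qlin_id [simp] = qlinI[OF id_expand]

lemma cf_zero [simp]: "cf (\<lambda>x. 0) j = 0"
  by (rule cf_unique[OF zero_expand])

lemma cf_add: "f \<in> qlin \<Longrightarrow> g \<in> qlin \<Longrightarrow> cf (\<lambda>x. f x + g x) j = cf f j + cf g j"
  by (simp add: cf_unique[OF add_expand])

lemma cf_frob_left: "f \<in> qlin \<Longrightarrow> cf (\<lambda>x. c * frob m (f x)) j = c * frob m (cf f (j - m))"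
  by (simp add: cf_unique[OF frob_left_expand]) (metis cf_mod mod_diff_left_eq)

lemma cf_frob_right: "f \<in> qlin \<Longrightarrow> cf (\<lambda>x. f (c * frob m x)) j = cf f (j - m) * frob (j - m) c"
  by (simp add: cf_unique[OF frob_right_expand]) (metis cf_mod frob_mod mod_diff_left_eq)

lemma cf_id: "cf (\<lambda>x. x) j = (if N dvd j then 1 else 0)"
  by (simp add: cf_unique[OF id_expand] dvd_eq_mod_eq_0)

lemma qlin_monom [simp]: "(\<lambda>x. c * frob m x) \<in> qlin"
  by (rule qlin_frob_left) simp

lemma cf_monom: "cf (\<lambda>x. c * frob m x) j = (if [j = m] (mod N) then c else 0)"
  using cf_frob_left[OF qlin_id, of c m j] by (simp add: cf_id cong_iff_dvd_diff)

lemma qlin_sum: "(\<And>i. i \<in> A \<Longrightarrow> F i \<in> qlin) \<Longrightarrow> (\<lambda>x. \<Sum>i\<in>A. F i x) \<in> qlin"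
  by (induction A rule: infinite_finite_induct) auto

lemma cf_sum: "(\<And>i. i \<in> A \<Longrightarrow> F i \<in> qlin) \<Longrightarrow> cf (\<lambda>x. \<Sum>i\<in>A. F i x) j = (\<Sum>i\<in>A. cf (F i) j)"
  by (induction A rule: infinite_finite_induct) (auto simp: cf_add qlin_sum)

lemma qlin_comp: "f \<in> qlin \<Longrightarrow> g \<in> qlin \<Longrightarrow> f \<circ> g \<in> qlin"
proof -
  assume f: "f \<in> qlin" and g: "g \<in> qlin"
  have "f \<circ> g = (\<lambda>x. \<Sum>i\<in>{0..<N}. cf f i * frob i (g x))"
    by (simp add: fun_eq_iff qlin_expand[OF f])
  with g show ?thesis
    by (auto intro: qlin_sum)
qed

text \<open>
  Distinct powers of Frobenius are independent characters; only two at a time are compared below.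
\<close>

lemma frob_pair_independent:
  assumes "\<And>x. A * frob i x = B * frob j x" and "\<not> [i = j] (mod N)"
  shows "A = 0 \<and> B = 0"
proof -
  have "(\<lambda>x. A * frob i x) = (\<lambda>x. B * frob j x)"
    using assms(1) by auto
  then have "cf (\<lambda>x. A * frob i x) i = cf (\<lambda>x. B * frob j x) i"
      and "cf (\<lambda>x. A * frob i x) j = cf (\<lambda>x. B * frob j x) j"
    by simp_all
  moreover have "\<not> [j = i] (mod N)"
    using assms(2) cong_sym by blast
  ultimately show ?thesis
    using assms(2) by (auto simp: cf_monom)
qed

lemma qlin_scalar:
  assumes "f \<in> qlin" and "\<And>j. cf f j \<noteq> 0 \<Longrightarrow> N dvd j"
  shows "f = (\<lambda>x. cf f 0 * x)"
proof
  fix x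
  have "f x = (\<Sum>i\<in>{0..<N}. if i = 0 then cf f 0 * x else 0)"
  proof (subst qlin_expand[OF assms(1)], intro sum.cong refl)
    fix i assume "i \<in> {0..<N}"
    then have "i = 0 \<or> \<not> N dvd i"
      using zdvd_not_zless[of i N] by auto
    with assms(2)[of i] show "cf f i * frob i x = (if i = 0 then cf f 0 * x else 0)"
      by auto
  qed
  then show "f x = cf f 0 * x"
    by simp
qed

section \<open>Fixed fields of powers of Frobenius\<close>

definition fixed_by :: "int \<Rightarrow> 'a set"
  where "fixed_by r = {x. frob r x = x}"

lemma Fsub_eq_fixed_by: "Fsub q n = fixed_by (int n)"
  by (simp add: Fsub_def fixed_by_def frob_nat)

lemma fixed_by_cong: "[r = r'] (mod N) \<Longrightarrow> fixed_by r = fixed_by r'"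
  using frob_cong by (auto simp: fixed_by_def)

lemma fixed_by_uminus: "fixed_by (- r) = fixed_by r"
proof -
  have "frob (- r) x = x \<longleftrightarrow> frob r x = x" for x
    using frob_frob[of r "- r" x] frob_frob[of "- r" r x] by auto
  then show ?thesis by (simp add: fixed_by_def)
qed

lemma fixed_by_mult: "x \<in> fixed_by r \<Longrightarrow> y \<in> fixed_by r \<Longrightarrow> x * y \<in> fixed_by r"
  by (simp add: fixed_by_def frob_mult)

lemma fixed_by_frob: "x \<in> fixed_by r \<Longrightarrow> frob j x \<in> fixed_by r"
  by (simp add: fixed_by_def frob_frob add.commute) (metis frob_frob)

lemma one_in_fixed_by [simp]: "1 \<in> fixed_by r" and zero_in_fixed_by [simp]: "0 \<in> fixed_by r"
  by (auto simp: fixed_by_def)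

lemma card_power_q_roots_le:
  fixes b y :: 'a
  assumes "0 < r"
  shows "card {x. x ^ (q ^ r) + b * x = y} \<le> q ^ r"
proof -
  define p where "p = monom 1 (q ^ r) + [:- y, b:]"
  have "1 < q ^ r"
    using q_gt_1 assms by (rule one_less_power)
  moreover have "degree [:- y, b:] \<le> 1"
    by simp
  ultimately have "degree p = q ^ r"
    unfolding p_def by (subst degree_add_eq_left) (auto simp: degree_monom_eq)
  moreover have "{x. x ^ (q ^ r) + b * x = y} = {x. poly p x = 0}"
    by (auto simp: p_def poly_monom algebra_simps)
  moreover have "p \<noteq> 0"
    using \<open>degree p = q ^ r\<close> \<open>1 < q ^ r\<close> by (metis degree_0 not_less_zero)
  ultimately show ?thesis
    using card_poly_roots_bound[of p] by simp
qed

lemma card_fixed_by_le: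
  assumes "0 < r"
  shows "card (fixed_by (int r)) \<le> q ^ r"
  using card_power_q_roots_le[OF assms, of "- 1" 0] by (simp add: fixed_by_def frob_nat)

text \<open>
  The trace \<open>x ^ (q ^ n) + x\<close> maps the field into the fixed field of \<open>frob n\<close>, and each of its fibres,
  being the zero set of a polynomial of degree \<open>q ^ n\<close>, has at most \<open>q ^ n\<close> elements.
\<close>

lemma card_subfield_ge: "q ^ n \<le> card (fixed_by (int n))"
proof -
  let ?T = "\<lambda>x::'a. x ^ (q ^ n) + 1 * x"
  have "frob (int n) (?T x) = ?T x" for x
    by (simp add: frob_add frob_power frob_nat flip: power_mult power_add mult_2)
  then have "(\<Union>y\<in>fixed_by (int n). {x. ?T x = y}) = UNIV"
    by (auto simp: fixed_by_def)
  then have "CARD('a) \<le> (\<Sum>y\<in>fixed_by (int n). card {x. ?T x = y})"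
    using card_UN_le[of "fixed_by (int n)" "\<lambda>y. {x. ?T x = y}"] by simp
  also have "\<dots> \<le> (\<Sum>y\<in>fixed_by (int n). q ^ n)"
    using n_ge_2 by (intro sum_mono card_power_q_roots_le) auto
  finally have "q ^ n * q ^ n \<le> card (fixed_by (int n)) * q ^ n"
    by (simp add: card_field mult_2 power_add)
  then show ?thesis
    using q_gt_1 by simp
qed

lemma card_subfield_less: "card (fixed_by (int n)) < CARD('a)"
proof -
  have "card (fixed_by (int n)) \<le> q ^ n"
    using n_ge_2 by (intro card_fixed_by_le) auto
  also have "\<dots> < q ^ (2 * n)"
    using q_gt_1 n_ge_2 by (intro power_strict_increasing) auto
  finally show ?thesis
    by (simp add: card_field)
qed

text \<open>
  With \<open>0 < r < N\<close>, the fixed field of \<open>frob r\<close> has at most \<open>q ^ r\<close> elements, so \<open>n \<le> r\<close>. It is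
  also the fixed field of the inverse map \<open>frob (N - r)\<close>, so \<open>n \<le> N - r = 2 * n - r\<close>.
\<close>

lemma large_fixed_by:
  assumes "q ^ n \<le> card (fixed_by r)" and "\<not> N dvd r"
  shows "[r = int n] (mod N)"
proof -
  have lower: "int n \<le> r' mod N" if "q ^ n \<le> card (fixed_by r')" "\<not> N dvd r'" for r'
  proof -
    define m where "m = nat (r' mod N)"
    have m: "int m = r' mod N"
      by (simp add: m_def)
    with that(2) have "0 < m"
      by (cases "m = 0") (auto simp: dvd_eq_mod_eq_0)
    have "fixed_by r' = fixed_by (int m)"
      by (rule fixed_by_cong) (simp add: m cong_def)
    with that(1) card_fixed_by_le[OF \<open>0 < m\<close>] have "q ^ n \<le> q ^ m"
      by simp
    with q_gt_1 show ?thesis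
      by (simp flip: m)
  qed
  have "(- r) mod N = N - r mod N"
    using assms(2) by (simp add: zmod_zminus1_eq_if dvd_eq_mod_eq_0)
  with lower[of r] lower[of "- r"] assms have "r mod N = int n"
    by (simp add: fixed_by_uminus N_def)
  then show ?thesis
    using n_ge_2 by (simp add: cong_def N_def)
qed

section \<open>Idealisers and code equivalence\<close>

text \<open>
  The bijections that normalise the ring of \<open>q\<close>-linear maps. Besides the invertible \<open>q\<close>-polynomials they
  include the field automorphisms, which are only semilinear; so both ingredients of a code
  equivalence can be treated alike.
\<close>

definition normalizer :: "('a \<Rightarrow> 'a) set"
  where "normalizer = {g. bij g \<and> (\<forall>\<phi>\<in>qlin. g \<circ> \<phi> \<circ> inv g \<in> qlin) \<and> (\<forall>\<phi>\<in>qlin. inv g \<circ> \<phi> \<circ> g \<in> qlin)}"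

text \<open>
  Conjugation by \<open>g\<close> is an injection of the finite set of \<open>q\<close>-linear maps into itself, hence onto, so
  conjugation by the inverse comes for free.
\<close>

lemma normalizerI:
  assumes "bij g" and "\<And>\<phi>. \<phi> \<in> qlin \<Longrightarrow> g \<circ> \<phi> \<circ> inv g \<in> qlin"
  shows "g \<in> normalizer"
proof -
  let ?c = "\<lambda>\<phi>. g \<circ> \<phi> \<circ> inv g"
  have undo: "inv g \<circ> ?c \<phi> \<circ> g = \<phi>" for \<phi>
    using assms(1) by (simp add: fun_eq_iff bij_is_inj)
  have "inj_on ?c qlin"
    by (rule inj_on_inverseI[where g="\<lambda>\<phi>. inv g \<circ> \<phi> \<circ> g"]) (rule undo)
  then have "?c ` qlin = qlin"
    using assms(2) by (intro endo_inj_surj) auto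
  then have "inv g \<circ> \<phi> \<circ> g \<in> qlin" if "\<phi> \<in> qlin" for \<phi>
    using that undo by (metis (no_types, lifting) imageE)
  with assms show ?thesis
    by (auto simp: normalizer_def)
qed

lemma normalizer_inv: "g \<in> normalizer \<Longrightarrow> inv g \<in> normalizer"
  by (auto simp: normalizer_def bij_imp_bij_inv inv_inv_eq)

lemma normalizer_comp:
  assumes "g \<in> normalizer" "h \<in> normalizer"
  shows "g \<circ> h \<in> normalizer"
proof (rule normalizerI)
  show "bij (g \<circ> h)"
    using assms by (auto simp: normalizer_def bij_comp)
  fix \<phi> assume "\<phi> \<in> qlin"
  then have "g \<circ> (h \<circ> \<phi> \<circ> inv h) \<circ> inv g \<in> qlin"
    using assms by (auto simp: normalizer_def)
  moreover have "inv (g \<circ> h) = inv h \<circ> inv g"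
    using assms by (auto simp: normalizer_def o_inv_distrib)
  ultimately show "g \<circ> h \<circ> \<phi> \<circ> inv (g \<circ> h) \<in> qlin"
    by (simp add: comp_assoc)
qed

text \<open>
  Composition with \<open>g\<close> on the right is an injection of the finite set of \<open>q\<close>-linear maps into itself,
  hence onto; this replaces an explicit \<open>q\<close>-polynomial for the inverse of \<open>g\<close>.
\<close>

lemma qlin_normalizer:
  assumes "g \<in> qlin" "bij g"
  shows "g \<in> normalizer"
proof (rule normalizerI[OF \<open>bij g\<close>])
  fix \<phi> assume \<phi>: "\<phi> \<in> qlin"
  have "inj_on (\<lambda>\<psi>. \<psi> \<circ> g) qlin"
    using assms(2) by (intro inj_on_inverseI[where g="\<lambda>\<psi>. \<psi> \<circ> inv g"])
      (simp add: fun_eq_iff bij_is_surj surj_f_inv_f)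
  then have "(\<lambda>\<psi>. \<psi> \<circ> g) ` qlin = qlin"
    using assms(1) qlin_comp by (intro endo_inj_surj) auto
  then obtain \<psi> where \<psi>: "\<psi> \<in> qlin" "g \<circ> \<phi> = \<psi> \<circ> g"
    using qlin_comp[OF assms(1) \<phi>] by (metis (no_types, lifting) imageE)
  then have "g \<circ> \<phi> \<circ> inv g = \<psi>"
    using assms(2) by (simp add: fun_eq_iff bij_is_surj surj_f_inv_f)
  with \<psi> show "g \<circ> \<phi> \<circ> inv g \<in> qlin"
    by simp
qed

lemma power_CHAR_normalizer: "(\<lambda>x. x ^ (CHAR('a) ^ e)) \<in> normalizer" (is "?\<rho> \<in> _")
proof (rule normalizerI[OF bij_power_CHAR])
  fix \<phi> assume \<phi>: "\<phi> \<in> qlin"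
  have surj: "?\<rho> (inv ?\<rho> x) = x" for x
    using bij_power_CHAR by (metis bij_is_surj surj_f_inv_f)
  have "?\<rho> \<circ> \<phi> \<circ> inv ?\<rho> = (\<lambda>x. \<Sum>i\<in>{0..<N}. ?\<rho> (cf \<phi> i) * frob i x)"
  proof
    fix x
    have "(?\<rho> \<circ> \<phi> \<circ> inv ?\<rho>) x = (\<Sum>i\<in>{0..<N}. ?\<rho> (cf \<phi> i) * frob i (?\<rho> (inv ?\<rho> x)))"
      using prime_char_finite_field[where 'a='a]
      by (simp add: qlin_expand[OF \<phi>, of "inv ?\<rho> x"] freshmans_dream_sum' power_mult_distrib frob_power)
    then show "(?\<rho> \<circ> \<phi> \<circ> inv ?\<rho>) x = (\<Sum>i\<in>{0..<N}. ?\<rho> (cf \<phi> i) * frob i x)"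
      by (simp only: surj)
  qed
  then show "?\<rho> \<circ> \<phi> \<circ> inv ?\<rho> \<in> qlin"
    by (rule qlinI)
qed

definition left_idealiser :: "('a \<Rightarrow> 'a) set \<Rightarrow> ('a \<Rightarrow> 'a) set"
  where "left_idealiser C = {\<phi>\<in>qlin. \<forall>f\<in>C. \<phi> \<circ> f \<in> C}"

definition right_idealiser :: "('a \<Rightarrow> 'a) set \<Rightarrow> ('a \<Rightarrow> 'a) set"
  where "right_idealiser C = {\<phi>\<in>qlin. \<forall>f\<in>C. f \<circ> \<phi> \<in> C}"

text \<open>
  Conjugation by \<open>g\<close> carries left idealisers to left idealisers, conjugation by \<open>inv h\<close> right
  idealisers to right idealisers.
\<close>

lemma card_idealisers_le:
  fixes C :: "('a \<Rightarrow> 'a) set"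
  assumes g: "g \<in> normalizer" and h: "h \<in> normalizer"
  defines "C' \<equiv> (\<lambda>f. g \<circ> f \<circ> h) ` C"
  shows "card (left_idealiser C) \<le> card (left_idealiser C')" and "card (right_idealiser C) \<le> card (right_idealiser C')"
proof -
  have inv_g: "inv g (g x) = x" and inv_h: "h (inv h x) = x" "inv h (h x) = x" for x
    using g h by (auto simp: normalizer_def bij_is_inj bij_is_surj surj_f_inv_f)
  show "card (left_idealiser C) \<le> card (left_idealiser C')"
  proof (rule card_inj_on_le[where f="\<lambda>\<phi>. g \<circ> \<phi> \<circ> inv g"])
    show "inj_on (\<lambda>\<phi>. g \<circ> \<phi> \<circ> inv g) (left_idealiser C)"
      by (rule inj_on_inverseI[where g="\<lambda>\<phi>. inv g \<circ> \<phi> \<circ> g"]) (simp add: fun_eq_iff inv_g)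
    have "g \<circ> \<phi> \<circ> inv g \<circ> (g \<circ> f \<circ> h) = g \<circ> (\<phi> \<circ> f) \<circ> h" for \<phi> f
      by (simp add: fun_eq_iff inv_g)
    with g show "(\<lambda>\<phi>. g \<circ> \<phi> \<circ> inv g) ` left_idealiser C \<subseteq> left_idealiser C'"
      unfolding left_idealiser_def C'_def normalizer_def by (auto simp del: comp_apply)
  qed simp
  show "card (right_idealiser C) \<le> card (right_idealiser C')"
  proof (rule card_inj_on_le[where f="\<lambda>\<phi>. inv h \<circ> \<phi> \<circ> h"])
    show "inj_on (\<lambda>\<phi>. inv h \<circ> \<phi> \<circ> h) (right_idealiser C)"
      by (rule inj_on_inverseI[where g="\<lambda>\<phi>. h \<circ> \<phi> \<circ> inv h"]) (simp add: fun_eq_iff inv_h)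
    have "g \<circ> f \<circ> h \<circ> (inv h \<circ> \<phi> \<circ> h) = g \<circ> (f \<circ> \<phi>) \<circ> h" for \<phi> f
      by (simp add: fun_eq_iff inv_h)
    with h show "(\<lambda>\<phi>. inv h \<circ> \<phi> \<circ> h) ` right_idealiser C \<subseteq> right_idealiser C'"
      unfolding right_idealiser_def C'_def normalizer_def by (auto simp del: comp_apply)
  qed simp
qed

lemma card_idealisers_eq:
  fixes C :: "('a \<Rightarrow> 'a) set"
  assumes g: "g \<in> normalizer" and h: "h \<in> normalizer"
  defines "C' \<equiv> (\<lambda>f. g \<circ> f \<circ> h) ` C"
  shows "card (left_idealiser C') = card (left_idealiser C)" and "card (right_idealiser C') = card (right_idealiser C)"
proof -
  have "(\<lambda>f. inv g \<circ> f \<circ> inv h) ` C' = (\<lambda>f. f) ` C"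
    unfolding C'_def image_image using g h
    by (intro image_cong refl)
       (simp add: normalizer_def fun_eq_iff bij_is_inj bij_is_surj surj_f_inv_f)
  then show "card (left_idealiser C') = card (left_idealiser C)" "card (right_idealiser C') = card (right_idealiser C)"
    using card_idealisers_le[OF g h, of C]
      card_idealisers_le[OF normalizer_inv[OF g] normalizer_inv[OF h], of C']
    by (simp_all add: C'_def)
qed

lemma poly_qmonom: "poly (qmonom q n c j) x = c * frob j x"
  by (simp add: qmonom_def poly_monom frob_def N_def)

lemma poly_qpolys: "f \<in> qpolys q n \<Longrightarrow> poly f \<in> qlin"
proof -
  assume "f \<in> qpolys q n"
  then obtain c where "f = (\<Sum>i<2 * n. qmonom q n (c i) (int i))"
    by (auto simp: qpolys_def)
  then have "poly f = (\<lambda>x. \<Sum>i<2 * n. c i * frob (int i) x)"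
    by (simp add: poly_sum poly_qmonom fun_eq_iff)
  then show ?thesis
    by (simp add: qlin_sum)
qed

lemma poly_qcompose: "poly (qcompose q n f (g :: 'a poly)) = poly f \<circ> poly g"
proof -
  have "poly (h mod (monom 1 (q ^ (2 * n)) - monom 1 1)) x = poly h x" for h :: "'a poly" and x
  proof -
    let ?m = "monom 1 (q ^ (2 * n)) - monom 1 1 :: 'a poly"
    have "poly h x = poly (h div ?m * ?m + h mod ?m) x"
      by (simp only: div_mult_mod_eq)
    also have "\<dots> = poly (h mod ?m) x"
      unfolding poly_add poly_mult by (simp add: poly_monom)
    finally show ?thesis by simp
  qed
  then show ?thesis
    by (simp add: qcompose_def qreduce_def poly_pcompose fun_eq_iff del: One_nat_def)
qed

lemma qlin_at_0: "f \<in> qlin \<Longrightarrow> f 0 = 0"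
  by (simp add: qlin_expand)

text \<open>
  The translation by \<open>\<psi>\<close> disappears when the target code is closed under subtraction: the source
  contains the zero map, so the target contains \<open>\<psi>\<close>. The automorphism \<open>\<rho>\<close> is moved into the two
  outer maps, as \<open>g = \<phi>1 \<circ> \<rho>\<close> and \<open>h = inv \<rho> \<circ> \<phi>2\<close>.
\<close>

lemma code_equivalent_functions:
  assumes "code_equivalent q n C1 C2" and "0 \<in> C1"
    and diff: "\<And>f g. f \<in> poly ` C2 \<Longrightarrow> g \<in> poly ` C2 \<Longrightarrow> (\<lambda>x. f x - g x) \<in> poly ` C2"
  obtains g h where "g \<in> normalizer" "h \<in> normalizer"
    "poly ` C2 = (\<lambda>f. g \<circ> f \<circ> h) ` poly ` C1"
proof -
  obtain \<phi>1 \<phi>2 \<psi> e where \<phi>: "\<phi>1 \<in> qpolys q n" "\<phi>2 \<in> qpolys q n" "bij (poly \<phi>1)" "bij (poly \<phi>2)"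
    and C2: "C2 = {qcompose q n \<phi>1 (qcompose q n (map_poly (\<lambda>x. x ^ (CHAR('a) ^ e)) f) \<phi>2) + \<psi> | f.
               f \<in> C1}"
    using assms(1) by (auto simp: code_equivalent_def)
  define \<rho> where "\<rho> = (\<lambda>x::'a. x ^ (CHAR('a) ^ e))"
  have \<rho>: "bij \<rho>" "\<rho> \<in> normalizer"
    unfolding \<rho>_def by (rule bij_power_CHAR, rule power_CHAR_normalizer)
  define g where "g = poly \<phi>1 \<circ> \<rho>"
  define h where "h = inv \<rho> \<circ> poly \<phi>2"
  have gh: "g \<in> normalizer" "h \<in> normalizer"
    unfolding g_def h_def using \<phi> \<rho>
    by (auto intro: normalizer_comp normalizer_inv qlin_normalizer poly_qpolys)
  have "poly (map_poly \<rho> f) = \<rho> \<circ> poly f \<circ> inv \<rho>" for f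
  proof
    fix x
    have "poly (map_poly \<rho> f) (\<rho> (inv \<rho> x)) = \<rho> (poly f (inv \<rho> x))"
      unfolding \<rho>_def by (rule poly_map_poly_power_CHAR)
    then show "poly (map_poly \<rho> f) x = (\<rho> \<circ> poly f \<circ> inv \<rho>) x"
      using \<rho>(1) by (simp add: bij_is_surj surj_f_inv_f)
  qed
  then have elem: "poly (qcompose q n \<phi>1 (qcompose q n (map_poly \<rho> f) \<phi>2) + \<psi>)
      = (\<lambda>x. (g \<circ> poly f \<circ> h) x + poly \<psi> x)" for f
    by (simp add: poly_qcompose g_def h_def fun_eq_iff)
  define A where "A = (\<lambda>f. g \<circ> f \<circ> h) ` poly ` C1"
  have S: "poly ` C2 = (\<lambda>f x. f x + poly \<psi> x) ` A"
    unfolding C2 A_def \<rho>_def[symmetric] Setcompr_eq_image image_image elem ..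
  have "g 0 = 0"
    using qlin_at_0[OF poly_qpolys[OF \<phi>(1)]] prime_char_finite_field[where 'a='a]
    by (simp add: g_def \<rho>_def power_0_left prime_gt_0_nat)
  then have "g \<circ> poly 0 \<circ> h = (\<lambda>x. 0)"
    by (simp add: fun_eq_iff)
  then have zero: "(\<lambda>x. 0) \<in> A"
    using assms(2) unfolding A_def by (metis imageI)
  then have psi: "poly \<psi> \<in> poly ` C2"
    unfolding S by (rule rev_image_eqI) simp
  have "A = poly ` C2"
  proof (intro equalityI subsetI)
    fix f assume "f \<in> A"
    then have "(\<lambda>x. f x + poly \<psi> x) \<in> poly ` C2"
      unfolding S by blast
    from diff[OF this psi] show "f \<in> poly ` C2"
      by simp
  next
    fix f assume "f \<in> poly ` C2"
    \<comment> \<open>Addition of \<open>\<psi>\<close> is expressed by subtractions only.\<close>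
    then have "(\<lambda>x. f x - ((poly \<psi> x - poly \<psi> x) - poly \<psi> x)) \<in> poly ` C2"
      by (intro diff psi)
    then have "(\<lambda>x. f x + poly \<psi> x) \<in> poly ` C2"
      by simp
    then obtain a where a: "a \<in> A" "(\<lambda>x. f x + poly \<psi> x) = (\<lambda>x. a x + poly \<psi> x)"
      unfolding S by auto
    then have "f = a"
      by (simp add: fun_eq_iff)
    with a show "f \<in> A" by simp
  qed
  with gh show thesis
    by (intro that[of g h]) (simp_all add: A_def)
qed

section \<open>Words with free inner coefficients\<close>

definition scalings :: "'a set \<Rightarrow> ('a \<Rightarrow> 'a) set"
  where "scalings A = (\<lambda>\<alpha> x. \<alpha> * x) ` A"

lemma card_scalings: "card (scalings A) = card A"
  unfolding scalings_def by (rule card_image) (auto simp: inj_on_def fun_eq_iff dest: spec[of _ 1])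

lemma finite_idealiser [simp]: "finite (left_idealiser C)" "finite (right_idealiser C)"
  by (auto intro: finite_subset[OF subset_UNIV])

lemma qlin_scaling [simp]: "(\<lambda>x. c * x) \<in> qlin"
  using qlin_monom[of c 0] by simp

lemma small_cong:
  assumes "[i = j] (mod N)" "\<bar>i - j\<bar> < N"
  shows "i = j"
  using assms zdvd_not_zless[of "\<bar>i - j\<bar>" N] by (auto simp: cong_iff_dvd_diff)

lemma frob_surj_scaled:
  assumes "A \<noteq> 0"
  obtains c where "A * frob j c = y"
proof -
  have "A * frob j (frob (- j) (y / A)) = y"
    using assms by (simp add: frob_frob)
  then show thesis by (rule that)
qed

lemma scaling_attains:
  assumes "A \<noteq> 0"
  obtains c where "c * frob j A = y"
proof -
  have "(y / frob j A) * frob j A = y"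
    using assms by simp
  then show thesis by (rule that)
qed

text \<open>
  If multiplication by \<open>\<phi>\<close>, from either side, keeps the monomials in positions \<open>a, \<dots>, b\<close> (counted in
  multiples of \<open>t\<close>) inside these positions, then every monomial of \<open>\<phi>\<close> translates the interval into
  itself, which leaves only position \<open>0\<close>.
\<close>

lemma scalar_of_shift_support:
  assumes "\<phi> \<in> qlin" and t: "coprime t N" and ab: "a \<le> b" "b - a + 1 < N"
    and shift: "\<And>m j. cf \<phi> (t * m) \<noteq> 0 \<Longrightarrow> a \<le> j \<Longrightarrow> j \<le> b \<Longrightarrow> \<exists>i\<in>{a..b}. [m + j = i] (mod N)"
  shows "\<phi> = (\<lambda>x. cf \<phi> 0 * x)"
proof (rule qlin_scalar[OF assms(1)])
  fix j assume j: "cf \<phi> j \<noteq> 0"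
  \<comment> \<open>Since \<open>t\<close> is a unit modulo \<open>N\<close>, every position \<open>j\<close> is, modulo \<open>N\<close>, a multiple of \<open>t\<close>.\<close>
  obtain t' where "[t * t' = 1] (mod N)"
    using t cong_solve_coprime_int by blast
  then have *: "[t * (t' * j) = j] (mod N)"
    using cong_scalar_right[of "t * t'" 1 N j] by (simp add: mult.assoc)
  then have "cf \<phi> (t * (t' * j)) \<noteq> 0"
    using j by (simp add: cf_cong)
  then have "N dvd t' * j"
    using shift by (intro interval_shift_invariant[OF ab]) auto
  then have "N dvd t * (t' * j)"
    by (rule dvd_mult)
  with * show "N dvd j"
    using cong_dvd_iff by blast
qed

text \<open>
  The shape common to the words of \<open>\<D>\<^sub>k\<^sub>,\<^sub>s(\<gamma>)\<close> and of \<open>\<H>\<^sub>k\<^sub>,\<^sub>t(\<eta>,h)\<close>: the coefficients \<open>c\<close> at the inner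
  positions are free in both codes, and only the end coefficients \<open>a\<close> and \<open>e\<close> are restricted.
\<close>

definition word :: "int \<Rightarrow> nat \<Rightarrow> 'a \<Rightarrow> (nat \<Rightarrow> 'a) \<Rightarrow> 'a \<Rightarrow> 'a \<Rightarrow> 'a"
  where "word s k a c e =
    (\<lambda>x. a * x + (\<Sum>i\<in>{1..k - 1}. c i * frob (s * int i) x) + e * frob (s * int k) x)"

lemma word_monom:
  assumes "0 < j" "j < k"
  shows "word s k 0 (\<lambda>i. if i = j then c else 0) 0 = (\<lambda>x. c * frob (s * int j) x)"
proof
  fix x
  have "(\<Sum>i\<in>{1..k - 1}. (if i = j then c else 0) * frob (s * int i) x)
      = (\<Sum>i\<in>{1..k - 1}. if i = j then c * frob (s * int j) x else 0)"
    by (intro sum.cong) auto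
  with assms show "word s k 0 (\<lambda>i. if i = j then c else 0) 0 x = c * frob (s * int j) x"
    by (simp add: word_def)
qed

lemma cf_word:
  assumes k: "1 \<le> k" "int k < N" and s: "coprime s N"
  shows "cf (word s k a c e) 0 = a" and "cf (word s k a c e) (s * int k) = e"
    and "cf (word s k a c e) (s * m) \<noteq> 0 \<Longrightarrow> \<exists>i\<in>{0..int k}. [m = i] (mod N)"
proof -
  have expand: "word s k a c e =
      (\<lambda>x. a * frob (s * 0) x + (\<Sum>i\<in>{1..k - 1}. c i * frob (s * int i) x) + e * frob (s * int k) x)"
    by (simp add: word_def)
  have cf: "cf (word s k a c e) (s * m) = (if [m = 0] (mod N) then a else 0)
     + (\<Sum>i\<in>{1..k - 1}. if [m = int i] (mod N) then c i else 0)
     + (if [m = int k] (mod N) then e else 0)" for m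
    unfolding expand
    by (subst cf_add cf_sum, (intro qlin_add qlin_sum qlin_monom)+)+
       (simp only: cf_monom cong_mult_lcancel[OF s])
  have distinct: "\<not> [i = j] (mod N)" if "i \<noteq> j" "i \<in> {0..int k}" "j \<in> {0..int k}" for i j
  proof
    assume "[i = j] (mod N)"
    moreover have "\<bar>i - j\<bar> < N"
      using that(2,3) k(2) unfolding atLeastAtMost_iff by arith
    ultimately show False
      using small_cong that(1) by blast
  qed
  have inner: "(\<Sum>i\<in>{1..k - 1}. if [m = int i] (mod N) then c i else 0) = 0"
    if "\<And>i. i \<in> {1..k - 1} \<Longrightarrow> \<not> [m = int i] (mod N)" for m
    using that by (intro sum.neutral) auto
  have "(\<Sum>i\<in>{1..k - 1}. if [0 = int i] (mod N) then c i else 0) = 0"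
      "(\<Sum>i\<in>{1..k - 1}. if [int k = int i] (mod N) then c i else 0) = 0"
    by (intro inner distinct; auto)+
  then show "cf (word s k a c e) 0 = a" "cf (word s k a c e) (s * int k) = e"
    using cf[of 0] cf[of "int k"] k distinct[of 0 "int k"] distinct[of "int k" 0] by auto
  show "\<exists>i\<in>{0..int k}. [m = i] (mod N)" if "cf (word s k a c e) (s * m) \<noteq> 0"
  proof (rule ccontr)
    assume no: "\<not> (\<exists>i\<in>{0..int k}. [m = i] (mod N))"
    then have "(\<Sum>i\<in>{1..k - 1}. if [m = int i] (mod N) then c i else 0) = 0"
      by (intro inner) auto
    with no that show False
      by (auto simp: cf)
  qed
qed

section \<open>The idealisers of D\<close>

context
  fixes k :: nat and s :: int and \<gamma> :: 'a
  assumes k: "1 \<le> k" "int k < N" and s: "coprime s N" and \<gamma>: "\<gamma> \<noteq> 0"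
begin

abbreviation "D \<equiv> poly ` code_D q n k s \<gamma>"
abbreviation "K \<equiv> fixed_by (int n)"

lemma s_cong_iff: "[s * i = s * j] (mod N) \<longleftrightarrow> [i = j] (mod N)"
  by (rule cong_mult_lcancel[OF s])

lemma D_eq: "D = {word s k a c (\<gamma> * b) | a b c. a \<in> K \<and> b \<in> K}"
proof -
  have "poly (qmonom q n a 0 + (\<Sum>i\<in>{1..k - 1}. qmonom q n (c i) (int i * s)) + qmonom q n (\<gamma> * b) (int k * s))
     = word s k a c (\<gamma> * b)" for a b c
    by (simp add: fun_eq_iff poly_qmonom poly_sum mult.commute[of s] word_def)
  then show ?thesis
    unfolding code_D_def Fsub_eq_fixed_by by (auto simp: image_iff) metis+
qed

lemma D_coefficients:
  assumes "f \<in> D"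
  shows "cf f 0 \<in> K" and "\<exists>b\<in>K. cf f (s * int k) = \<gamma> * b"
    and "cf f (s * m) \<noteq> 0 \<Longrightarrow> \<exists>i\<in>{0..int k}. [m = i] (mod N)"
proof -
  obtain a b c where "a \<in> K" "b \<in> K" "f = word s k a c (\<gamma> * b)"
    using assms unfolding D_eq by blast
  then show "cf f 0 \<in> K" "\<exists>b\<in>K. cf f (s * int k) = \<gamma> * b"
      "cf f (s * m) \<noteq> 0 \<Longrightarrow> \<exists>i\<in>{0..int k}. [m = i] (mod N)"
    using cf_word[OF k s] by auto
qed

lemma D_members:
  shows "(\<lambda>x. x) \<in> D" and "(\<lambda>x. \<gamma> * frob (s * int k) x) \<in> D"
    and "0 < j \<Longrightarrow> j < k \<Longrightarrow> (\<lambda>x. c * frob (s * int j) x) \<in> D"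
proof -
  have "word s k 1 (\<lambda>_. 0) (\<gamma> * 0) \<in> D" "word s k 0 (\<lambda>_. 0) (\<gamma> * 1) \<in> D"
      "word s k 0 (\<lambda>i. if i = j then c else 0) (\<gamma> * 0) \<in> D"
    unfolding D_eq using one_in_fixed_by zero_in_fixed_by by blast+
  then show "(\<lambda>x. x) \<in> D" "(\<lambda>x. \<gamma> * frob (s * int k) x) \<in> D"
      "0 < j \<Longrightarrow> j < k \<Longrightarrow> (\<lambda>x. c * frob (s * int j) x) \<in> D"
    using word_monom[of j k s c] by (simp_all add: word_def)
qed

lemma D_end_member:
  assumes "j \<in> {0, int k}"
  obtains c where "c \<noteq> 0" "(\<lambda>x. c * frob (s * j) x) \<in> D"
proof (cases "j = 0")
  case True
  show thesis
    by (rule that[of 1]) (use True D_members(1) in simp_all)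
next
  case False
  then have "j = int k"
    using assms by simp
  then show thesis
    using that[of \<gamma>] D_members(2) \<gamma> by simp
qed

lemma D_scalings: "scalings K \<subseteq> left_idealiser D" "scalings K \<subseteq> right_idealiser D"
proof -
  have "(\<lambda>x. \<alpha> * x) \<circ> f \<in> D" "f \<circ> (\<lambda>x. \<alpha> * x) \<in> D" if "\<alpha> \<in> K" "f \<in> D" for \<alpha> f
  proof -
    obtain a b c where ab: "a \<in> K" "b \<in> K" and f: "f = word s k a c (\<gamma> * b)"
      using \<open>f \<in> D\<close> unfolding D_eq by auto
    have "(\<lambda>x. \<alpha> * x) \<circ> f = word s k (\<alpha> * a) (\<lambda>i. \<alpha> * c i) (\<gamma> * (\<alpha> * b))"
      by (auto simp: f word_def fun_eq_iff distrib_left sum_distrib_left mult_ac)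
    then show "(\<lambda>x. \<alpha> * x) \<circ> f \<in> D"
      unfolding D_eq using ab \<open>\<alpha> \<in> K\<close> fixed_by_mult by blast
    have "f \<circ> (\<lambda>x. \<alpha> * x)
        = word s k (a * \<alpha>) (\<lambda>i. c i * frob (s * int i) \<alpha>) (\<gamma> * (b * frob (s * int k) \<alpha>))"
      by (auto simp: f word_def fun_eq_iff frob_mult mult_ac)
    then show "f \<circ> (\<lambda>x. \<alpha> * x) \<in> D"
      unfolding D_eq using ab \<open>\<alpha> \<in> K\<close> fixed_by_mult fixed_by_frob by blast
  qed
  then show "scalings K \<subseteq> left_idealiser D" "scalings K \<subseteq> right_idealiser D"
    by (auto simp: scalings_def left_idealiser_def right_idealiser_def)
qed

text \<open>
  Both idealisers satisfy the assumptions: products of the end monomials with \<open>\<phi>\<close> reach a nonzero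
  coefficient, and products with the inner monomials reach every value, in the position that
  a monomial of \<open>\<phi>\<close> sends them to. In the code, the end coefficients are confined to
  \<open>K\<close> and \<open>\<gamma> K\<close>, so inner positions can only be sent to inner positions. For \<open>k = 1\<close>
  there are none, but then the two end positions themselves form a proper interval, because \<open>N \<ge> 4\<close>.
\<close>

lemma D_scalar:
  assumes \<phi>: "\<phi> \<in> qlin"
    and ends: "\<And>m j. cf \<phi> (s * m) \<noteq> 0 \<Longrightarrow> j \<in> {0, int k} \<Longrightarrow> \<exists>f\<in>D. cf f (s * (m + j)) \<noteq> 0"
    and mid: "\<And>m j y. cf \<phi> (s * m) \<noteq> 0 \<Longrightarrow> 0 < j \<Longrightarrow> j < int k \<Longrightarrow> \<exists>f\<in>D. cf f (s * (m + j)) = y"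
  shows "\<phi> = (\<lambda>x. cf \<phi> 0 * x)"
proof (cases "k = 1")
  case True
  show ?thesis
  proof (rule scalar_of_shift_support[OF \<phi> s, of 0 1])
    fix m j :: int assume "cf \<phi> (s * m) \<noteq> 0" "0 \<le> j" "j \<le> 1"
    then obtain f where "f \<in> D" "cf f (s * (m + j)) \<noteq> 0"
      using ends[of m j] True by force
    then show "\<exists>i\<in>{0..1}. [m + j = i] (mod N)"
      using D_coefficients(3)[of f "m + j"] True by simp
  qed (use N_ge_4 in auto)
next
  case False
  \<comment> \<open>The end coefficients omit a value: \<open>y0\<close> at position \<open>0\<close>, and \<open>\<gamma> * y0\<close> at position \<open>k\<close>.\<close>
  obtain y0 where y0: "y0 \<notin> K"
    using card_subfield_less by (metis UNIV_eq_I less_irrefl)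
  show ?thesis
  proof (rule scalar_of_shift_support[OF \<phi> s, of 1 "int k - 1"])
    fix m j :: int assume m: "cf \<phi> (s * m) \<noteq> 0" "1 \<le> j" "j \<le> int k - 1"
    obtain f where "f \<in> D" "cf f (s * (m + j)) = 1"
      using mid[of m j 1] m by auto
    then obtain i where i: "i \<in> {0..int k}" "[m + j = i] (mod N)"
      using D_coefficients(3)[of f "m + j"] by auto
    have "i \<noteq> 0"
    proof
      assume "i = 0"
      obtain f where "f \<in> D" "cf f (s * (m + j)) = y0"
        using mid[of m j y0] m by auto
      moreover have "cf f (s * (m + j)) = cf f 0" for f
        using i \<open>i = 0\<close> s_cong_iff[of "m + j" 0] by (intro cf_cong) simp
      ultimately show False
        using D_coefficients(1) y0 by auto
    qed
    moreover have "i \<noteq> int k"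
    proof
      assume "i = int k"
      obtain f where "f \<in> D" "cf f (s * (m + j)) = \<gamma> * y0"
        using mid[of m j "\<gamma> * y0"] m by auto
      moreover have "cf f (s * (m + j)) = cf f (s * int k)" for f
        using i \<open>i = int k\<close> s_cong_iff by (intro cf_cong) simp
      ultimately show False
        using D_coefficients(2) y0 \<gamma> by (metis mult_left_cancel)
    qed
    ultimately show "\<exists>i\<in>{1..int k - 1}. [m + j = i] (mod N)"
      using i by (intro bexI[of _ i]) auto
  qed (use False k in auto)
qed

text \<open>
  Once \<open>\<phi>\<close> is known to be a scaling, its factor lies in \<open>K\<close> because the code contains the identity
  and has its coefficients at position \<open>0\<close> in \<open>K\<close>.
\<close>

lemma left_idealiser_D: "left_idealiser D \<subseteq> scalings K"
proof
  fix \<phi> assume "\<phi> \<in> left_idealiser D"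
  then have \<phi>: "\<phi> \<in> qlin" and closed: "\<And>f. f \<in> D \<Longrightarrow> \<phi> \<circ> f \<in> D"
    by (auto simp: left_idealiser_def)
  have cf: "cf (\<phi> \<circ> (\<lambda>x. c * frob (s * j) x)) (s * (m + j)) = cf \<phi> (s * m) * frob (s * m) c" for c j m
    using cf_frob_right[OF \<phi>, of c "s * j" "s * (m + j)"] by (simp add: o_def distrib_left)
  have "\<phi> = (\<lambda>x. cf \<phi> 0 * x)"
  proof (rule D_scalar[OF \<phi>])
    fix m j assume m: "cf \<phi> (s * m) \<noteq> 0" and "j \<in> {0, int k}"
    from this(2) obtain c where c: "c \<noteq> 0" "(\<lambda>x. c * frob (s * j) x) \<in> D"
      by (rule D_end_member)
    have "cf (\<phi> \<circ> (\<lambda>x. c * frob (s * j) x)) (s * (m + j)) \<noteq> 0"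
      using m c(1) by (simp only: cf) simp
    with closed[OF c(2)] show "\<exists>f\<in>D. cf f (s * (m + j)) \<noteq> 0"
      by blast
  next
    fix m j y assume m: "cf \<phi> (s * m) \<noteq> 0" and "0 < j" "j < int k"
    then have "(\<lambda>x. c * frob (s * j) x) \<in> D" for c
      using D_members(3)[of "nat j" c] by auto
    moreover obtain c where "cf \<phi> (s * m) * frob (s * m) c = y"
      using m by (rule frob_surj_scaled)
    ultimately show "\<exists>f\<in>D. cf f (s * (m + j)) = y"
      using closed cf by metis
  qed
  moreover have "cf \<phi> 0 \<in> K"
    using D_coefficients(1)[OF closed[OF D_members(1)]] by (simp add: o_def)
  ultimately show "\<phi> \<in> scalings K"
    by (auto simp: scalings_def)
qed

lemma right_idealiser_D: "right_idealiser D \<subseteq> scalings K"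
proof
  fix \<phi> assume "\<phi> \<in> right_idealiser D"
  then have \<phi>: "\<phi> \<in> qlin" and closed: "\<And>f. f \<in> D \<Longrightarrow> f \<circ> \<phi> \<in> D"
    by (auto simp: right_idealiser_def)
  have cf: "cf ((\<lambda>x. c * frob (s * j) x) \<circ> \<phi>) (s * (m + j)) = c * frob (s * j) (cf \<phi> (s * m))" for c j m
    using cf_frob_left[OF \<phi>, of c "s * j" "s * (m + j)"] by (simp add: o_def distrib_left)
  have "\<phi> = (\<lambda>x. cf \<phi> 0 * x)"
  proof (rule D_scalar[OF \<phi>])
    fix m j assume m: "cf \<phi> (s * m) \<noteq> 0" and "j \<in> {0, int k}"
    from this(2) obtain c where c: "c \<noteq> 0" "(\<lambda>x. c * frob (s * j) x) \<in> D"
      by (rule D_end_member)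
    have "cf ((\<lambda>x. c * frob (s * j) x) \<circ> \<phi>) (s * (m + j)) \<noteq> 0"
      using m c(1) by (simp only: cf) simp
    with closed[OF c(2)] show "\<exists>f\<in>D. cf f (s * (m + j)) \<noteq> 0"
      by blast
  next
    fix m j y assume m: "cf \<phi> (s * m) \<noteq> 0" and "0 < j" "j < int k"
    then have "(\<lambda>x. c * frob (s * j) x) \<in> D" for c
      using D_members(3)[of "nat j" c] by auto
    moreover obtain c where "c * frob (s * j) (cf \<phi> (s * m)) = y"
      using m by (rule scaling_attains)
    ultimately show "\<exists>f\<in>D. cf f (s * (m + j)) = y"
      using closed cf by metis
  qed
  moreover have "cf \<phi> 0 \<in> K"
    using D_coefficients(1)[OF closed[OF D_members(1)]] by (simp add: o_def)
  ultimately show "\<phi> \<in> scalings K"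
    by (auto simp: scalings_def)
qed

lemma card_left_idealiser_D: "card (left_idealiser D) = card K" and card_right_idealiser_D: "card (right_idealiser D) = card K"
  using left_idealiser_D right_idealiser_D D_scalings card_scalings by (metis subset_antisym)+

end

section \<open>The idealisers of Gabidulin and twisted Gabidulin codes\<close>

lemma qlin_additive:
  assumes "\<phi> \<in> qlin"
  shows "\<phi> (x + y) = \<phi> x + \<phi> y"
  by (simp add: qlin_expand[OF assms] frob_add distrib_left sum.distrib)

lemma frob_pair_vanish:
  assumes "\<And>x. A * frob i x + B * frob j x = 0" and "\<not> [i = j] (mod N)"
  shows "A = 0 \<and> B = 0"
  using frob_pair_independent[of A i "- B" j] assms by (simp add: eq_neg_iff_add_eq_0)

context
  fixes k :: nat and t :: int
  assumes t: "coprime t N"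
begin

abbreviation G :: "('a \<Rightarrow> 'a) set" where "G \<equiv> poly ` gabidulin q n k t"

lemma G_eq: "G = {\<lambda>x. \<Sum>i<k. a i * frob (t * int i) x | a. True}"
proof -
  have "poly (\<Sum>i<k. qmonom q n (a i) (t * int i)) = (\<lambda>x. \<Sum>i<k. a i * frob (t * int i) x)" for a
    by (simp add: fun_eq_iff poly_qmonom poly_sum)
  then show ?thesis
    unfolding gabidulin_def by (auto simp: image_iff) metis
qed

lemma G_diff: "f \<in> G \<Longrightarrow> g \<in> G \<Longrightarrow> (\<lambda>x. f x - g x) \<in> G"
proof -
  assume "f \<in> G" "g \<in> G"
  then obtain a b where "f = (\<lambda>x. \<Sum>i<k. a i * frob (t * int i) x)" "g = (\<lambda>x. \<Sum>i<k. b i * frob (t * int i) x)"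
    unfolding G_eq by blast
  then have "(\<lambda>x. f x - g x) = (\<lambda>x. \<Sum>i<k. (a i - b i) * frob (t * int i) x)"
    by (simp add: fun_eq_iff left_diff_distrib sum_subtractf)
  then show ?thesis
    unfolding G_eq by (intro CollectI exI[of _ "\<lambda>i. a i - b i"]) simp
qed

lemma scalings_left_idealiser_G: "scalings UNIV \<subseteq> left_idealiser G"
proof -
  have "(\<lambda>x. \<alpha> * x) \<circ> f \<in> G" if "f \<in> G" for \<alpha> f
  proof -
    obtain a where "f = (\<lambda>x. \<Sum>i<k. a i * frob (t * int i) x)"
      using \<open>f \<in> G\<close> unfolding G_eq by blast
    then have "(\<lambda>x. \<alpha> * x) \<circ> f = (\<lambda>x. \<Sum>i<k. (\<alpha> * a i) * frob (t * int i) x)"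
      by (simp add: fun_eq_iff sum_distrib_left mult.assoc)
    then show ?thesis
      unfolding G_eq by (intro CollectI exI[of _ "\<lambda>i. \<alpha> * a i"]) simp
  qed
  then show ?thesis
    by (auto simp: scalings_def left_idealiser_def)
qed

end

context
  fixes k :: nat and t :: int and h :: nat and \<eta> :: 'a
  assumes k: "1 \<le> k" "int k < N" and t: "coprime t N" and \<eta>: "\<eta> \<noteq> 0"
begin

abbreviation "H \<equiv> poly ` twisted_gabidulin q n k t \<eta> h"

lemma H_eq: "H = {word t k a c (\<eta> * frob (int h) a) | a c. True}"
proof -
  have lhs: "poly ((\<Sum>i<k. qmonom q n (a i) (t * int i)) + qmonom q n (\<eta> * a 0 ^ (q ^ h)) (t * int k))
      = word t k (a 0) a (\<eta> * frob (int h) (a 0))" for a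
  proof -
    have "{..<k} = insert 0 {1..k - 1}"
      using k by auto
    then show ?thesis
      by (simp add: fun_eq_iff poly_qmonom poly_sum word_def frob_nat)
  qed
  have rhs: "word t k a c e = word t k ((c(0 := a)) 0) (c(0 := a)) e" for a c e
    by (simp add: word_def)
  show ?thesis
  proof (intro equalityI subsetI)
    fix f assume "f \<in> H"
    then show "f \<in> {word t k a c (\<eta> * frob (int h) a) | a c. True}"
      unfolding twisted_gabidulin_def using lhs by blast
  next
    fix f assume "f \<in> {word t k a c (\<eta> * frob (int h) a) | a c. True}"
    then obtain a c where "f = word t k a c (\<eta> * frob (int h) a)"
      by blast
    then have "f = word t k ((c(0 := a)) 0) (c(0 := a)) (\<eta> * frob (int h) ((c(0 := a)) 0))"
      using rhs by simp
    then show "f \<in> H"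
      unfolding twisted_gabidulin_def lhs[symmetric] by blast
  qed
qed

lemma H_coefficients:
  assumes "f \<in> H"
  shows "cf f (t * int k) = \<eta> * frob (int h) (cf f 0)"
    and "cf f (t * m) \<noteq> 0 \<Longrightarrow> \<exists>i\<in>{0..int k}. [m = i] (mod N)"
proof -
  obtain a c where "f = word t k a c (\<eta> * frob (int h) a)"
    using assms unfolding H_eq by blast
  then show "cf f (t * int k) = \<eta> * frob (int h) (cf f 0)"
      "cf f (t * m) \<noteq> 0 \<Longrightarrow> \<exists>i\<in>{0..int k}. [m = i] (mod N)"
    using cf_word[OF k t] by auto
qed

lemma H_members:
  shows "(\<lambda>x. a * x + \<eta> * frob (int h) a * frob (t * int k) x) \<in> H"
    and "0 < j \<Longrightarrow> j < int k \<Longrightarrow> (\<lambda>x. c * frob (t * j) x) \<in> H"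
proof -
  have "word t k a (\<lambda>_. 0) (\<eta> * frob (int h) a) \<in> H"
      "word t k 0 (\<lambda>i. if i = nat j then c else 0) (\<eta> * frob (int h) 0) \<in> H"
    unfolding H_eq by blast+
  then show "(\<lambda>x. a * x + \<eta> * frob (int h) a * frob (t * int k) x) \<in> H"
      "0 < j \<Longrightarrow> j < int k \<Longrightarrow> (\<lambda>x. c * frob (t * j) x) \<in> H"
    using word_monom[of "nat j" k t c] by (simp_all add: word_def)
qed

lemma H_diff: "f \<in> H \<Longrightarrow> g \<in> H \<Longrightarrow> (\<lambda>x. f x - g x) \<in> H"
proof -
  assume "f \<in> H" "g \<in> H"
  then obtain a c a' c' where "f = word t k a c (\<eta> * frob (int h) a)" "g = word t k a' c' (\<eta> * frob (int h) a')"
    unfolding H_eq by blast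
  then have "(\<lambda>x. f x - g x) = word t k (a - a') (\<lambda>i. c i - c' i) (\<eta> * frob (int h) (a - a'))"
    by (simp add: fun_eq_iff word_def left_diff_distrib right_diff_distrib sum_subtractf frob_diff)
  then show ?thesis
    unfolding H_eq by blast
qed

text \<open>
  If \<open>h\<close> is divisible by \<open>N\<close>, the twist is linear, and the last coefficient is the fixed multiple \<open>\<eta> * a\<close>
  of the first; scaling on the left preserves this relation.
\<close>

lemma scalings_left_idealiser_H:
  assumes "N dvd int h"
  shows "scalings UNIV \<subseteq> left_idealiser H"
proof -
  have "frob (int h) = frob 0"
    using assms by (intro frob_cong) (simp add: cong_0_iff)
  then have H: "H = {word t k a c (\<eta> * a) | a c. True}"
    unfolding H_eq by simp
  have "(\<lambda>x. \<alpha> * x) \<circ> f \<in> H" if "f \<in> H" for \<alpha> f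
  proof -
    obtain a c where "f = word t k a c (\<eta> * a)"
      using \<open>f \<in> H\<close> unfolding H by blast
    then have "(\<lambda>x. \<alpha> * x) \<circ> f = word t k (\<alpha> * a) (\<lambda>i. \<alpha> * c i) (\<eta> * (\<alpha> * a))"
      by (simp add: fun_eq_iff word_def distrib_left sum_distrib_left mult_ac)
    then show ?thesis
      unfolding H by blast
  qed
  then show ?thesis
    by (auto simp: scalings_def left_idealiser_def)
qed

text \<open>
  If \<open>h\<close> is congruent to \<open>t * k\<close>, scaling the argument by \<open>\<alpha>\<close> multiplies the last coefficient by
  exactly the power of \<open>\<alpha>\<close> that the twist requires.
\<close>

lemma scalings_right_idealiser_H:
  assumes "[int h = t * int k] (mod N)"
  shows "scalings UNIV \<subseteq> right_idealiser H"
proof -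
  have fr: "frob (t * int k) = frob (int h)"
    using assms by (intro frob_cong) (rule cong_sym)
  have "f \<circ> (\<lambda>x. \<alpha> * x) \<in> H" if "f \<in> H" for \<alpha> f
  proof -
    obtain a c where "f = word t k a c (\<eta> * frob (int h) a)"
      using \<open>f \<in> H\<close> unfolding H_eq by blast
    then have "f \<circ> (\<lambda>x. \<alpha> * x)
        = word t k (a * \<alpha>) (\<lambda>i. c i * frob (t * int i) \<alpha>) (\<eta> * frob (int h) (a * \<alpha>))"
      by (simp add: fun_eq_iff word_def frob_mult fr mult_ac)
    then show ?thesis
      unfolding H_eq by blast
  qed
  then show ?thesis
    by (auto simp: scalings_def right_idealiser_def)
qed

text \<open>
  The inner positions, or the two ends if \<open>k = 1\<close>, again form an interval that the positions of \<open>\<phi>\<close> must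
  translate into itself.
  The three assumptions exclude, in turn, that an end monomial leaves the interval \<open>0, \<dots>, k\<close>, that
  an inner one leaves it, and that an inner one lands on an end.
\<close>

lemma H_scalar:
  assumes \<phi>: "\<phi> \<in> qlin"
    and ends: "\<And>i. \<forall>j\<in>{0..int k}. \<not> [i = j] (mod N) \<Longrightarrow> cf \<phi> (t * i) = 0 \<and> cf \<phi> (t * (i - int k)) = 0"
    and mid: "\<And>m j. cf \<phi> (t * m) \<noteq> 0 \<Longrightarrow> 0 < j \<Longrightarrow> j < int k \<Longrightarrow> \<exists>f\<in>H. cf f (t * (m + j)) \<noteq> 0"
    and mid_ends: "\<And>j. 0 < j \<Longrightarrow> j < int k \<Longrightarrow> cf \<phi> (t * (- j)) = 0 \<and> cf \<phi> (t * (int k - j)) = 0"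
  shows "\<phi> = (\<lambda>x. cf \<phi> 0 * x)"
proof (cases "k = 1")
  case True
  show ?thesis
  proof (rule scalar_of_shift_support[OF \<phi> t, of 0 1])
    fix m j :: int assume m: "cf \<phi> (t * m) \<noteq> 0" and "0 \<le> j" "j \<le> 1"
    then have "j = 0 \<or> j = int k"
      using True by auto
    then have "\<not> (cf \<phi> (t * (m + j)) = 0 \<and> cf \<phi> (t * (m + j - int k)) = 0)"
      using m by auto
    then show "\<exists>i\<in>{0..1}. [m + j = i] (mod N)"
      using ends[of "m + j"] True by auto
  qed (use N_ge_4 in auto)
next
  case False
  show ?thesis
  proof (rule scalar_of_shift_support[OF \<phi> t, of 1 "int k - 1"])
    fix m j :: int assume m: "cf \<phi> (t * m) \<noteq> 0" and j: "1 \<le> j" "j \<le> int k - 1"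
    obtain f where "f \<in> H" "cf f (t * (m + j)) \<noteq> 0"
      using mid[of m j] m j by auto
    then obtain i where i: "i \<in> {0..int k}" "[m + j = i] (mod N)"
      using H_coefficients(2)[of f "m + j"] by auto
    have "[t * m = t * (i - j)] (mod N)"
      using i(2) by (intro cong_scalar_left) (simp add: cong_iff_dvd_diff algebra_simps)
    then have "cf \<phi> (t * (i - j)) \<noteq> 0"
      using m cf_cong by metis
    then have "i \<noteq> 0" "i \<noteq> int k"
      using mid_ends[of j] j by auto
    then show "\<exists>i\<in>{1..int k - 1}. [m + j = i] (mod N)"
      using i by (intro bexI[of _ i]) auto
  qed (use False k in auto)
qed

text \<open>
  The first and last coefficients of a word determine each other by a map that
  involves \<open>frob h\<close>, while an inner monomial with free coefficient \<open>c\<close> contributes \<open>frob\<close>-conjugates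
  of \<open>c\<close> to both ends. The powers of \<open>frob\<close> that have to agree differ by \<open>t * k - h\<close>, so unless this is
  \<open>0\<close> modulo \<open>N\<close> both contributions vanish. The same comparison of exponents handles the words
  made of the two end monomials.
\<close>

lemma left_idealiser_H:
  assumes h: "\<not> [int h = t * int k] (mod N)"
  shows "left_idealiser H \<subseteq> scalings (fixed_by (int h))"
proof
  fix \<phi> assume "\<phi> \<in> left_idealiser H"
  then have \<phi>: "\<phi> \<in> qlin" and closed: "\<And>f. f \<in> H \<Longrightarrow> \<phi> \<circ> f \<in> H"
    by (auto simp: left_idealiser_def)
  have cf: "cf (\<phi> \<circ> (\<lambda>x. c * frob (t * j) x)) (t * (m + j)) = cf \<phi> (t * m) * frob (t * m) c" for c j m
    using cf_frob_right[OF \<phi>, of c "t * j" "t * (m + j)"] by (simp add: o_def distrib_left)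
  have cf_end: "cf (\<phi> \<circ> (\<lambda>x. a * x + e * frob (t * int k) x)) (t * i)
      = cf \<phi> (t * i) * frob (t * i) a + cf \<phi> (t * (i - int k)) * frob (t * (i - int k)) e" for a e i
  proof -
    have "\<phi> \<circ> (\<lambda>x. a * x + e * frob (t * int k) x) = (\<lambda>x. \<phi> (a * frob 0 x) + \<phi> (e * frob (t * int k) x))"
      using qlin_additive[OF \<phi>] by (simp add: fun_eq_iff)
    then show ?thesis
      by (simp only: cf_add[OF qlin_frob_right[OF \<phi>] qlin_frob_right[OF \<phi>]] cf_frob_right[OF \<phi>])
         (simp add: right_diff_distrib)
  qed
  have scalar: "\<phi> = (\<lambda>x. cf \<phi> 0 * x)"
  proof (rule H_scalar[OF \<phi>])
    fix i assume i: "\<forall>j\<in>{0..int k}. \<not> [i = j] (mod N)"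
    have "cf \<phi> (t * i) * frob (t * i) a
        + cf \<phi> (t * (i - int k)) * frob (t * (i - int k)) \<eta> * frob (t * (i - int k) + int h) a = 0" for a
      using H_coefficients(2)[OF closed[OF H_members(1)[of a]], of i] i
      unfolding cf_end by (auto simp: frob_mult frob_frob mult.assoc)
    moreover have "\<not> [t * i = t * (i - int k) + int h] (mod N)"
      using h by (simp add: cong_iff_dvd_diff algebra_simps) (metis dvd_minus_iff minus_diff_eq)
    ultimately have "cf \<phi> (t * i) = 0 \<and> cf \<phi> (t * (i - int k)) * frob (t * (i - int k)) \<eta> = 0"
      by (rule frob_pair_vanish)
    with \<eta> show "cf \<phi> (t * i) = 0 \<and> cf \<phi> (t * (i - int k)) = 0"
      by simp
  next
    fix m j assume "cf \<phi> (t * m) \<noteq> 0" "0 < j" "j < int k"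
    then show "\<exists>f\<in>H. cf f (t * (m + j)) \<noteq> 0"
      using closed[OF H_members(2)[of j 1]] cf[of 1 j m] by (intro bexI) auto
  next
    fix j assume j: "0 < j" "j < int k"
    have "cf \<phi> (t * (int k - j)) * frob (t * (int k - j)) c
        = \<eta> * frob (int h) (cf \<phi> (t * (- j))) * frob (int h + t * (- j)) c" for c
      using H_coefficients(1)[OF closed[OF H_members(2)[OF j, of c]]]
        cf[of c j "int k - j"] cf[of c j "- j"]
      by (simp add: frob_mult frob_frob mult.assoc)
    moreover have "\<not> [t * (int k - j) = int h + t * (- j)] (mod N)"
      using h by (simp add: cong_iff_dvd_diff algebra_simps) (metis dvd_minus_iff minus_diff_eq)
    ultimately have "cf \<phi> (t * (int k - j)) = 0 \<and> \<eta> * frob (int h) (cf \<phi> (t * (- j))) = 0"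
      by (rule frob_pair_independent)
    with \<eta> show "cf \<phi> (t * (- j)) = 0 \<and> cf \<phi> (t * (int k - j)) = 0"
      by simp
  qed
  define d where "d = cf \<phi> 0"
  have "\<phi> \<circ> (\<lambda>x. 1 * x + \<eta> * frob (int h) 1 * frob (t * int k) x) = word t k d (\<lambda>_. 0) (d * \<eta>)"
    by (subst scalar) (simp add: word_def fun_eq_iff d_def algebra_simps)
  then have "d * \<eta> = \<eta> * frob (int h) d"
    using H_coefficients(1)[OF closed[OF H_members(1)[of 1]]] cf_word[OF k t] by simp
  then have "d \<in> fixed_by (int h)"
    using \<eta> by (simp add: fixed_by_def)
  with scalar show "\<phi> \<in> scalings (fixed_by (int h))"
    by (auto simp: scalings_def d_def)
qed

text \<open>
  The argument is that of \<open>left_idealiser_H\<close>, except that the free coefficient \<open>c\<close> is now not acted on by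
  \<open>\<phi>\<close>, so the exponents to compare are \<open>0\<close> and \<open>h\<close>.
\<close>

lemma right_idealiser_H:
  assumes h: "\<not> N dvd int h"
  shows "right_idealiser H \<subseteq> scalings (fixed_by (t * int k - int h))"
proof
  fix \<phi> assume "\<phi> \<in> right_idealiser H"
  then have \<phi>: "\<phi> \<in> qlin" and closed: "\<And>f. f \<in> H \<Longrightarrow> f \<circ> \<phi> \<in> H"
    by (auto simp: right_idealiser_def)
  have h': "\<not> [0 = int h] (mod N)"
    using h by (simp add: cong_iff_dvd_diff)
  have cf: "cf ((\<lambda>x. c * frob (t * j) x) \<circ> \<phi>) (t * (m + j)) = c * frob (t * j) (cf \<phi> (t * m))" for c j m
    using cf_frob_left[OF \<phi>, of c "t * j" "t * (m + j)"] by (simp add: o_def distrib_left)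
  have cf_end: "cf ((\<lambda>x. a * x + e * frob (t * int k) x) \<circ> \<phi>) (t * i)
      = a * cf \<phi> (t * i) + e * frob (t * int k) (cf \<phi> (t * (i - int k)))" for a e i
  proof -
    have "(\<lambda>x. a * x + e * frob (t * int k) x) \<circ> \<phi> = (\<lambda>x. a * frob 0 (\<phi> x) + e * frob (t * int k) (\<phi> x))"
      by (simp add: fun_eq_iff)
    then show ?thesis
      by (simp only: cf_add[OF qlin_frob_left[OF \<phi>] qlin_frob_left[OF \<phi>]] cf_frob_left[OF \<phi>])
         (simp add: right_diff_distrib)
  qed
  have scalar: "\<phi> = (\<lambda>x. cf \<phi> 0 * x)"
  proof (rule H_scalar[OF \<phi>])
    fix i assume i: "\<forall>j\<in>{0..int k}. \<not> [i = j] (mod N)"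
    have "cf \<phi> (t * i) * frob 0 a
        + \<eta> * frob (t * int k) (cf \<phi> (t * (i - int k))) * frob (int h) a = 0" for a
      using H_coefficients(2)[OF closed[OF H_members(1)[of a]], of i] i
      unfolding cf_end by (auto simp: mult_ac)
    from frob_pair_vanish[OF this h'] \<eta>
    show "cf \<phi> (t * i) = 0 \<and> cf \<phi> (t * (i - int k)) = 0"
      by simp
  next
    fix m j assume "cf \<phi> (t * m) \<noteq> 0" "0 < j" "j < int k"
    then show "\<exists>f\<in>H. cf f (t * (m + j)) \<noteq> 0"
      using closed[OF H_members(2)[of j 1]] cf[of 1 j m] by (intro bexI) auto
  next
    fix j assume j: "0 < j" "j < int k"
    have "frob (t * j) (cf \<phi> (t * (int k - j))) * frob 0 c
        = \<eta> * frob (int h + t * j) (cf \<phi> (t * (- j))) * frob (int h) c" for c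
      using H_coefficients(1)[OF closed[OF H_members(2)[OF j, of c]]]
        cf[of c j "int k - j"] cf[of c j "- j"]
      by (simp add: frob_mult frob_frob mult_ac)
    from frob_pair_independent[OF this h'] \<eta>
    show "cf \<phi> (t * (- j)) = 0 \<and> cf \<phi> (t * (int k - j)) = 0"
      by simp
  qed
  define d where "d = cf \<phi> 0"
  have "(\<lambda>x. 1 * x + \<eta> * frob (int h) 1 * frob (t * int k) x) \<circ> \<phi>
      = word t k d (\<lambda>_. 0) (\<eta> * frob (t * int k) d)"
    by (subst scalar) (simp add: word_def fun_eq_iff d_def frob_mult mult_ac)
  then have "\<eta> * frob (t * int k) d = \<eta> * frob (int h) d"
    using H_coefficients(1)[OF closed[OF H_members(1)[of 1]]] cf_word[OF k t] by simp
  then have "frob (- int h) (frob (t * int k) d) = frob (- int h) (frob (int h) d)"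
    using \<eta> by simp
  then have "d \<in> fixed_by (t * int k - int h)"
    by (simp add: fixed_by_def frob_frob)
  with scalar show "\<phi> \<in> scalings (fixed_by (t * int k - int h))"
    by (auto simp: scalings_def d_def)
qed

end

section \<open>Inequivalence\<close>

lemma zero_in_code_D: "0 \<in> code_D q n k s (\<gamma> :: 'a)"
  unfolding code_D_def Fsub_eq_fixed_by
  by (rule CollectI, rule exI[of _ 0], rule exI[of _ 0], rule exI[of _ "\<lambda>_. 0"]) (simp add: qmonom_def)

text \<open>
  A Gabidulin code is closed under all scalings on the left, so its left idealiser is larger than
  that of \<open>\<D>\<^sub>k\<^sub>,\<^sub>s(\<gamma>)\<close>.
\<close>

lemma D_not_equivalent_G:
  assumes "1 \<le> k" "int k < N" "coprime s N" "\<gamma> \<noteq> 0" "coprime t N"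
  shows "\<not> code_equivalent q n (code_D q n k s (\<gamma>::'a)) (gabidulin q n k' t)"
proof
  assume "code_equivalent q n (code_D q n k s \<gamma>) (gabidulin q n k' t)"
  then obtain g h where "g \<in> normalizer" "h \<in> normalizer"
    "poly ` gabidulin q n k' t = (\<lambda>f. g \<circ> f \<circ> h) ` poly ` code_D q n k s \<gamma>"
    using code_equivalent_functions[OF _ zero_in_code_D G_diff] assms(5) by metis
  then have "card (left_idealiser (poly ` gabidulin q n k' t)) = card (fixed_by (int n))"
    using card_idealisers_eq(1) card_left_idealiser_D[OF assms(1-4)] by simp
  moreover have "CARD('a) \<le> card (left_idealiser (poly ` gabidulin q n k' t))"
    using card_mono[OF _ scalings_left_idealiser_G[OF assms(5)]] by (simp add: card_scalings)
  ultimately show False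
    using card_subfield_less by simp
qed

text \<open>
  Since the idealisers of \<open>\<D>\<^sub>k\<^sub>,\<^sub>s(\<gamma>)\<close> have the order of the fixed field of \<open>frob n\<close>, the degenerate cases, in
  which one idealiser contains all scalings, cannot occur. Hence \<open>h\<close> and \<open>t * k - h\<close> must both be
  congruent to \<open>n\<close>, so that \<open>2 * n\<close> divides \<open>t * k\<close> and therefore \<open>k\<close>.
\<close>

lemma D_not_equivalent_H:
  assumes k: "1 \<le> k" "int k < N" and "coprime s N" "\<gamma> \<noteq> 0" and t: "coprime t N" and \<eta>: "\<eta> \<noteq> 0"
  shows "\<not> code_equivalent q n (code_D q n k s (\<gamma>::'a)) (twisted_gabidulin q n k t \<eta> h)"
proof
  let ?H = "poly ` twisted_gabidulin q n k t \<eta> h"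
  assume "code_equivalent q n (code_D q n k s \<gamma>) (twisted_gabidulin q n k t \<eta> h)"
  then obtain g h' where gh: "g \<in> normalizer" "h' \<in> normalizer"
    "?H = (\<lambda>f. g \<circ> f \<circ> h') ` poly ` code_D q n k s \<gamma>"
    using code_equivalent_functions[OF _ zero_in_code_D H_diff[OF k t \<eta>]] by metis
  have card: "card (left_idealiser ?H) = card (fixed_by (int n))" "card (right_idealiser ?H) = card (fixed_by (int n))"
    unfolding gh(3) using card_idealisers_eq[OF gh(1,2)] card_left_idealiser_D[OF assms(1-4)] card_right_idealiser_D[OF assms(1-4)]
    by simp_all
  have small: "\<not> scalings UNIV \<subseteq> left_idealiser ?H" "\<not> scalings UNIV \<subseteq> right_idealiser ?H"
    using card card_subfield_less card_mono[of "left_idealiser ?H" "scalings UNIV"]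
      card_mono[of "right_idealiser ?H" "scalings UNIV"] by (auto simp: card_scalings)
  have h: "\<not> N dvd int h"
    using small(1) scalings_left_idealiser_H[OF k t \<eta>] by blast
  have tk: "\<not> [int h = t * int k] (mod N)"
    using small(2) scalings_right_idealiser_H[OF k t \<eta>] by blast
  have "q ^ n \<le> card (fixed_by (int h))"
    using card_mono[OF _ left_idealiser_H[OF k t \<eta> tk]] card(1) card_subfield_ge
    by (simp add: card_scalings)
  then have 1: "[int h = int n] (mod N)"
    using h by (rule large_fixed_by)
  have "q ^ n \<le> card (fixed_by (t * int k - int h))"
    using card_mono[OF _ right_idealiser_H[OF k t \<eta> h]] card(2) card_subfield_ge
    by (simp add: card_scalings)
  moreover have "\<not> N dvd t * int k - int h"
    using tk by (metis cong_iff_dvd_diff cong_sym)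
  ultimately have "[t * int k - int h = int n] (mod N)"
    by (rule large_fixed_by)
  from cong_add[OF this 1] have "[t * int k = N] (mod N)"
    by (simp add: N_def)
  then have "N dvd int k"
    using t by (simp add: cong_0_iff coprime_commute coprime_dvd_mult_right_iff cong_def dvd_eq_mod_eq_0[symmetric])
  then show False
    using k zdvd_not_zless[of "int k" N] by simp
qed

end

theorem corollary8:
  fixes q n k :: nat and s :: int and \<gamma> :: "'a::{field,finite}"
  assumes "primepow q"
    and "n \<ge> 2"
    and "CARD('a) = q ^ (2 * n)"
    and "gcd s (int (2 * n)) = 1"
    and "1 \<le> k" and "k \<le> 2 * n - 1"
    and "\<not> (\<exists>y\<in>Fsub q 1. norm_Fq q n \<gamma> = y ^ 2)"
  shows "(\<forall>k' t. gcd t (int (2 * n)) = 1 \<longrightarrow>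
            \<not> code_equivalent q n (code_D q n k s \<gamma>) (gabidulin q n k' t)) \<and>
         (\<forall>t h (\<eta>::'a).
            gcd t (int (2 * n)) = 1 \<and> h \<le> 2 * n - 1 \<and>
            norm_Fq q n \<eta> \<noteq> (- 1) ^ (2 * n * k) \<and> \<eta> \<noteq> 0 \<and> (k \<noteq> n \<or> h \<noteq> n) \<longrightarrow>
            \<not> code_equivalent q n (code_D q n k s \<gamma>) (twisted_gabidulin q n k t \<eta> h))"
proof -
  interpret field_q2n q n "TYPE('a)"
    using assms(1-3) by unfold_locales
  have "\<gamma> \<noteq> 0"
  proof
    assume "\<gamma> = 0"
    then have "norm_Fq q n \<gamma> = 0 ^ 2"
      using assms(2) q_gt_1 by (auto simp: norm_Fq_def power_0_left intro!: prod_zero bexI[of _ 0])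
    moreover have "(0::'a) \<in> Fsub q 1"
      using q_gt_1 by (simp add: Fsub_def)
    ultimately show False
      using assms(7) by blast
  qed
  moreover have "int k < N"
    using assms(2,6) by (simp add: N_def)
  moreover have coprime: "coprime u N" if "gcd u (int (2 * n)) = 1" for u
    using that by (simp add: N_def coprime_iff_gcd_eq_1)
  ultimately show ?thesis
    using D_not_equivalent_G[OF assms(5)] D_not_equivalent_H[OF assms(5)] assms(4) by simp
qed

end
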